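(* Let $\mathbf{p}=(p_1,p_2,\ldots)$ be a non-degenerate probability distribution supported on $[a]=\{1,\ldots,a\}$, and let $k$ be a fixed positive integer. Then $$d_K\left(\frac{Y_{n,k}^{(\mathbf{p})}-\mathbb{E}[Y_{n,k}^{(\mathbf{p})}]}{\beta_n},\ \mathcal{G}\right)\le\frac{C}{\sqrt n},$$ where $\beta_n\sim\sqrt{\mathrm{Var}(Y_{n,k}^{(\mathbf{p})})}$ as $n\to\infty$, $$\mathbb{E}[Y_{n,k}^{(\mathbf{p})}]=\binom nk\sum_{(x_1,\ldots,x_a)\in S_{a,k}}\left(\prod_{i=1}^ap_i^{x_i}\right),$$ and $\mathrm{Var}(Y_{n,k}^{(\mathbf{p})})=\mathbb{E}[(Y_{n,k}^{(\mathbf{p})})^2]-(\mathbb{E}[Y_{n,k}^{(\mathbf{p})}])^2$ with $$\mathbb{E}[(Y_{n,k}^{(\mathbf{p})})^2]=\sum_{t=0}^{k}\binom{n}{2k-t}\sum_{\substack{(a_1,\ldots,a_{t+1}):\ a_i\in\mathbb{N}\cup\{0\}\\ \{\lambda^1_i\},\{\lambda^2_i\}\in S_{t+1,k-t}}}\Big(\prod_{i=1}^{t}p_{a_i}\Big)\prod_{i=1}^{t+1}\binom{\lambda_i^1+\lambda_i^2}{\lambda_i^1}\times\Bigg[\sum_{\substack{\{x^1_{ij}\}\in S_{a_i,\lambda^1_i}\\ \{x^2_{ij}\}\in S_{a_i,\lambda_i^2}}}\ \prod_{j=1}^{a_i}p_j^{\,x^1_{ij}x^2_{ij}}\Bigg],$$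 the bracket (which depends on $i$) being a factor of the product over $i$. Here $C$ is constant with respect to $n$, but depends on $k$ and $\mathbf{p}$. In particular, $(Y_{n,k}^{(\mathbf{p})}-\mathbb{E}[Y_{n,k}^{(\mathbf{p})}])/\sqrt{\mathrm{Var}(Y_{n,k}^{(\mathbf{p})})}$ converges in distribution to $\mathcal{G}$ as $n\to\infty$.
   Context: $X_1,X_2,\ldots$ are i.i.d. random variables with $\mathbb{P}(X_1=j)=p_j$, $j\in\mathbb{N}=\{1,2,\ldots\}$ (so $p_j=0$ for $j\notin[a]$, and $p_0=\mathbb{P}(X_1=0)=0$); non-degenerate means not concentrated at a single point. $Y_{n,k}^{(\mathbf{p})}=\sum_{1\le i_1<\cdots<i_k\le n}\mathbf{1}(X_{i_1}\le\cdots\le X_{i_k})$ is the number of weakly increasing subsequences of length $k$ of $X_1,\ldots,X_n$. $S_{m,l}=\{(x_1,\ldots,x_m):x_i\in\mathbb{N}\cup\{0\},\ x_1+\cdots+x_m=l\}$; in the second-moment formula, $\{\lambda^r_i\}=(\lambda^r_1,\ldots,\lambda^r_{t+1})$ and, for each $i$, $\{x^r_{ij}\}=(x^r_{i1},\ldots,x^r_{ia_i})$, $r=1,2$. $d_K(U,V)=\sup_{z\in\mathbb{R}}|\mathbb{P}(U\le z)-\mathbb{P}(V\le z)|$ is the Kolmogorov distance (between laws), $\mathcal{G}$ is a standard normal random variable, and $a_n\sim b_n$ means $a_n/b_n\to1$.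
   Formalization: The d_K bound and the convergence are stated for k≥2 (for k=1 the variance is 0); the printed second-moment sum diverges (a_{t+1} is free) and is corrected: 1≤a_1≤…≤a_t≤a_{t+1}=a, a_0=1, letters j of block i in {a_{i-1},…,a_i}, exponent x^1_{ij}+x^2_{ij}. *)

theory Defs
  imports "HOL-Probability.Probability"
begin

text \<open>The index tuples \<open>i\<^sub>1 < \<dots> < i\<^sub>k\<close> in \<open>{1..n}\<close> are strictly sorted lists.\<close>

definition inc_tuples :: "nat \<Rightarrow> nat \<Rightarrow> nat list set" where
  "inc_tuples n k = {is. length is = k \<and> sorted_wrt (<) is \<and> set is \<subseteq> {1..n}}"

definition num_wis :: "(nat \<Rightarrow> 'b \<Rightarrow> nat) \<Rightarrow> nat \<Rightarrow> nat \<Rightarrow> 'b \<Rightarrow> real" where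
  "num_wis X n k \<omega> = (\<Sum>is \<in> inc_tuples n k. of_bool (sorted (map (\<lambda>i. X i \<omega>) is)))"

definition kolmogorov_dist :: "real measure \<Rightarrow> real measure \<Rightarrow> real" where
  "kolmogorov_dist \<mu> \<nu> = (SUP z. \<bar>cdf \<mu> z - cdf \<nu> z\<bar>)"

text \<open>
  Weak compositions of \<open>l\<close> with parts indexed by a finite set \<open>J\<close>; the set written
  \<open>S\<^sub>m\<^sub>,\<^sub>l\<close> is \<open>weak_comps {1..m} l\<close>.
\<close>

definition weak_comps :: "nat set \<Rightarrow> nat \<Rightarrow> (nat \<Rightarrow> nat) set" where
  "weak_comps J l = {x \<in> J \<rightarrow>\<^sub>E UNIV. (\<Sum>j\<in>J. x j) = l}"

text \<open>
  Possible values \<open>\<alpha>\<^sub>1 \<le> \<dots> \<le> \<alpha>\<^sub>t\<close> of the letters at the \<open>t\<close> positions shared by two increasing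
  subsequences of a word over \<open>{1..a}\<close>, with the sentinels \<open>\<alpha>\<^sub>0 = 1\<close> and \<open>\<alpha>\<^sub>t\<^sub>+\<^sub>1 = a\<close>.
\<close>

definition shared_values :: "nat \<Rightarrow> nat \<Rightarrow> (nat \<Rightarrow> nat) set" where
  "shared_values a t =
     {\<alpha> \<in> {0..t + 1} \<rightarrow>\<^sub>E UNIV. \<alpha> 0 = 1 \<and> \<alpha> (t + 1) = a \<and> (\<forall>i\<in>{1..t + 1}. \<alpha> (i - 1) \<le> \<alpha> i)}"

text \<open>
  Second moment of the number of weakly increasing subsequences. Two position sets with \<open>t\<close>
  common elements cover \<open>2 * k - t\<close> positions; the shared positions split the remaining ones
  into \<open>t + 1\<close> blocks, and block \<open>i\<close> has \<open>u i\<close> positions used by the first set only and \<open>v i\<close>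
  used by the second only. The letters in block \<open>i\<close> lie in \<open>{\<alpha> (i - 1)..\<alpha> i}\<close>, and \<open>x j\<close>,
  \<open>y j\<close> count the letters \<open>j\<close> that the two subsequences have there, contributing
  \<open>p\<^sub>j ^ x j * p\<^sub>j ^ y j\<close>.
\<close>

definition second_moment :: "nat pmf \<Rightarrow> nat \<Rightarrow> nat \<Rightarrow> nat \<Rightarrow> real" where
  "second_moment p a n k =
     (\<Sum>t = 0..k. real (n choose (2 * k - t)) *
       (\<Sum>\<alpha> \<in> shared_values a t.
        \<Sum>u \<in> weak_comps {1..t + 1} (k - t). \<Sum>v \<in> weak_comps {1..t + 1} (k - t).
          (\<Prod>i = 1..t. pmf p (\<alpha> i)) *
          (\<Prod>i = 1..t + 1. real ((u i + v i) choose (u i)) *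
             (\<Sum>x \<in> weak_comps {\<alpha> (i - 1)..\<alpha> i} (u i).
              \<Sum>y \<in> weak_comps {\<alpha> (i - 1)..\<alpha> i} (v i).
                \<Prod>j = \<alpha> (i - 1)..\<alpha> i. pmf p j ^ (x j + y j)))))"

end

theory Submission
  imports Defs
begin

text \<open>
  The moment formulas come from a recursion on the last letter. Count the weakly increasing
  subsequences of length \<open>k\<close> with letters at most \<open>b\<close>: those that use the last position are
  obtained by appending its letter \<open>c \<le> b\<close> to a subsequence of length \<open>k - 1\<close> with letters at
  most \<open>c\<close>. Multiplying two such recursions and taking expectations gives a recursion for
  the mixed second moment with four terms, according to whether the last position is used by
  neither subsequence, by one of them or by both. The claimed sum satisfies the same recursion
  (\<open>pair_moment_Suc\<close>): Pascal's rule for \<open>n choose (2 * k - t)\<close> accounts for the unused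
  position, and a recursion for the weight of a pattern of overlap (\<open>pattern_weight_step\<close>) for
  the others.

  The normal approximation takes \<open>\<beta> n = sqrt (V n)\<close>. Resampling one letter changes the count by at
  most \<open>n ^ (k - 1)\<close>, and the effect of resampling one letter is changed by at most
  \<open>2 * n ^ (k - 2)\<close> when another is resampled. The variance has order \<open>n ^ (2 * k - 1)\<close>
  (\<open>wis_variance_growth\<close>), since raising a letter near the end of the word raises
  the count by a mean amount of order \<open>n ^ (k - 1)\<close>. Hence the
  standardised count has first differences of order \<open>1 / sqrt n\<close> and second differences of
  order \<open>1 / sqrt n ^ 3\<close>.

  For a standardised function \<open>F\<close> of independent letters these two bounds alone give a
  Berry--Esseen rate (\<open>second_order_berry_esseen\<close>), by Stein's argument with exchangeable pairs.
  Let \<open>F'\<close> be \<open>F\<close> after resampling letter \<open>i\<close>, and \<open>f\<close> a solution of Stein's equation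
  \<open>f' w - w * f w = of_bool (w \<le> z) - Phi z\<close>. Exchangeability turns the expectation of
  \<open>(F - F') * f F\<close> into half of that of \<open>(F - F') * (f F - f F')\<close>, and a
  Taylor step replaces this by half of the expectation of \<open>(F - F')\<^sup>2 * f' F\<close>. Because \<open>f'\<close> is, up
  to a constant, a sum of a bounded nondecreasing and a bounded nonincreasing function, the Taylor
  error is bounded by the expectation of \<open>\<bar>F - F'\<bar> * (F - F')\<close> times the increment of a bounded
  nondecreasing function of \<open>F\<close>; exchangeability applies again and leaves the conditional mean
  of \<open>\<bar>F - F'\<bar> * (F - F')\<close>, which has expectation zero. What remains is the fluctuation of two sums of
  conditional means and of the nonlinear part of \<open>F\<close>, and all three are controlled by the
  Efron--Stein inequality.
\<close>

section \<open>Stein's equation for the normal law\<close>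

definition Phi :: "real \<Rightarrow> real" where "Phi = cdf std_normal_distribution"

abbreviation (input) phi :: "real \<Rightarrow> real" where "phi \<equiv> std_normal_density"

interpretation std_normal: real_distribution std_normal_distribution
  by (rule real_dist_normal_dist)

lemma Phi_diff: "a \<le> b \<Longrightarrow> Phi b - Phi a = integral {a..b} phi"
proof -
  assume ab: "a \<le> b"
  have int: "set_integrable lborel A phi" if "A \<in> sets borel" for A
    unfolding set_integrable_def
    by (rule integrable_mult_indicator) (use that integrable_normal_density in auto)
  have "Phi b - Phi a = measure std_normal_distribution {a<..b}"
  proof (cases "a = b")
    case False with ab show ?thesis unfolding Phi_def by (intro std_normal.cdf_diff_eq) auto
  qed auto
  also have "\<dots> = (LINT x|std_normal_distribution. indicator {a<..b} x)"
    by simp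
  also have "\<dots> = (LINT x|lborel. phi x * indicator {a<..b} x)"
    by (subst integral_density) auto
  also have "\<dots> = (LINT x:{a<..b}|lborel. phi x)"
    by (simp add: set_lebesgue_integral_def mult.commute)
  also have "\<dots> = (LINT x:{a..b}|lborel. phi x)"
    unfolding set_lebesgue_integral_def
    by (intro integral_cong_AE)
      (auto simp: indicator_def intro!: AE_I[where N="{a}"] )
  also have "\<dots> = integral {a..b} phi"
    using set_borel_integral_eq_integral(2)[OF int[of "{a..b}"]] by simp
  finally show ?thesis .
qed

lemma phi_pos: "0 < phi x"
  by (rule normal_density_pos) simp

lemma phi_has_derivative: "(phi has_real_derivative - x * phi x) (at x)"
  unfolding std_normal_density_def[abs_def]
  by (auto intro!: derivative_eq_intros simp: field_simps power2_eq_square)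

lemma Phi_has_derivative: "(Phi has_real_derivative phi x) (at x)"
proof -
  have c: "continuous_on {x-1..x+1} phi"
    by (meson DERIV_isCont phi_has_derivative continuous_at_imp_continuous_on)
  have "((\<lambda>u. integral {x-1..u} phi) has_real_derivative phi x) (at x within {x-1..x+1})"
    by (rule integral_has_real_derivative[OF c]) auto
  hence "((\<lambda>u. integral {x-1..u} phi) has_real_derivative phi x) (at x within {x-1<..<x+1})"
    by (rule DERIV_subset) auto
  hence "((\<lambda>u. integral {x-1..u} phi) has_real_derivative phi x) (at x)"
    by (subst (asm) at_within_open) auto
  hence d: "((\<lambda>u. Phi (x-1) + integral {x-1..u} phi) has_real_derivative phi x) (at x)"
    by (rule DERIV_add[OF DERIV_const, of "\<lambda>u. integral {x-1..u} phi" "phi x" x UNIV, simplified])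
  show ?thesis
  proof (rule has_field_derivative_transform_within[OF d, of 1])
    fix u assume "dist u x < 1"
    hence "x - 1 \<le> u" by (simp add: dist_real_def)
    from Phi_diff[OF this] show "Phi (x - 1) + integral {x - 1..u} phi = Phi u" by linarith
  qed auto
qed

lemma Phi_nonneg: "0 \<le> Phi x"
  unfolding Phi_def by (rule std_normal.cdf_nonneg)

lemma Phi_le_1: "Phi x \<le> 1"
  unfolding Phi_def by (rule std_normal.cdf_bounded_prob)

lemma Phi_at_top: "(Phi \<longlongrightarrow> 1) at_top"
  unfolding Phi_def by (rule std_normal.cdf_lim_at_top_prob)

lemma Phi_at_bot: "(Phi \<longlongrightarrow> 0) at_bot"
  unfolding Phi_def by (rule std_normal.cdf_lim_at_bot)

lemma Phi_minus: "Phi (- x) = 1 - Phi x"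
proof -
  have phi_minus: "phi (- y) = phi y" for y by (simp add: std_normal_density_def)
  have "((\<lambda>u. Phi u + Phi (- u)) has_real_derivative 0) (at y)" for y
    using DERIV_add[OF Phi_has_derivative[of y] DERIV_chain2[OF Phi_has_derivative DERIV_minus[OF DERIV_ident]]]
    by (simp add: phi_minus)
  hence "Phi u + Phi (-u) = Phi x + Phi (- x)" for u
    by (metis DERIV_isconst_all)
  hence "((\<lambda>u. Phi u + Phi (- u)) \<longlongrightarrow> Phi x + Phi (-x)) at_top"
    by (intro tendsto_eventually always_eventually) simp
  moreover have "((\<lambda>u. Phi u + Phi (- u)) \<longlongrightarrow> 1 + 0) at_top"
    by (intro tendsto_add Phi_at_top
          filterlim_compose[OF Phi_at_bot filterlim_uminus_at_bot_at_top])
  ultimately have "Phi x + Phi (-x) = 1 + 0"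
    by (rule tendsto_unique[OF trivial_limit_at_top_linorder])
  thus ?thesis by simp
qed

text \<open>
  All bounds on the lower normal tail follow from this principle: the expression in question tends
  to zero at minus infinity and has a nonnegative derivative.
\<close>

lemma nonneg_of_deriv_nonneg_lim_at_bot:
  fixes G :: "real \<Rightarrow> real"
  assumes "\<And>u. u \<le> w \<Longrightarrow> (G has_real_derivative G' u) (at u)"
    and "\<And>u. u \<le> w \<Longrightarrow> 0 \<le> G' u" and "(G \<longlongrightarrow> 0) at_bot"
  shows "0 \<le> G w"
proof -
  have "G u \<le> G w" if "u \<le> w" for u
    by (rule DERIV_nonneg_imp_nondecreasing[OF that]) (use assms(1,2) in blast)
  hence "eventually (\<lambda>u. G u \<le> G w) at_bot"
    by (rule eventually_mono[OF eventually_le_at_bot[of w]])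
  thus ?thesis by (intro tendsto_upperbound[OF assms(3)]) auto
qed

text \<open>
  This crude Gaussian tail bound serves only to make \<open>c u * Phi u\<close> vanish at minus infinity for
  polynomial factors \<open>c\<close>.
\<close>

lemma Phi_le_phi: "w \<le> -1 \<Longrightarrow> Phi w \<le> phi w"
proof -
  assume w: "w \<le> -1"
  have phi_at_bot: "(phi \<longlongrightarrow> 0) at_bot"
    unfolding std_normal_density_def[abs_def] by real_asymp
  have "0 \<le> phi w - Phi w"
  proof (rule nonneg_of_deriv_nonneg_lim_at_bot[where G = "\<lambda>u. phi u - Phi u" and G' = "\<lambda>u. - u * phi u - phi u"])
    show "((\<lambda>u. phi u - Phi u) has_real_derivative - u * phi u - phi u) (at u)" for u
      by (intro derivative_intros phi_has_derivative Phi_has_derivative)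
    show "0 \<le> - u * phi u - phi u" if "u \<le> w" for u
    proof -
      have "0 \<le> (- u - 1) * phi u" using that w phi_pos[of u] by simp
      thus ?thesis by (simp add: algebra_simps)
    qed
    show "((\<lambda>u. phi u - Phi u) \<longlongrightarrow> 0) at_bot"
      using tendsto_diff[OF phi_at_bot Phi_at_bot] by simp
  qed
  thus ?thesis by simp
qed

lemma power_phi_tendsto_0:
  "(phi \<longlongrightarrow> 0) at_bot" "((\<lambda>u. u * phi u) \<longlongrightarrow> 0) at_bot" "((\<lambda>u. u\<^sup>2 * phi u) \<longlongrightarrow> 0) at_bot"
  unfolding std_normal_density_def[abs_def] by real_asymp+

lemma times_Phi_tendsto_0:
  assumes "((\<lambda>u. c u * phi u) \<longlongrightarrow> 0) at_bot"
  shows "((\<lambda>u. c u * Phi u) \<longlongrightarrow> 0) at_bot"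
proof (rule Lim_null_comparison)
  show "eventually (\<lambda>u. norm (c u * Phi u) \<le> norm (c u * phi u)) at_bot"
    using eventually_le_at_bot[of "-1"]
    by eventually_elim
      (auto simp: abs_mult Phi_nonneg intro!: mult_left_mono Phi_le_phi)
  show "((\<lambda>u. norm (c u * phi u)) \<longlongrightarrow> 0) at_bot"
    using assms by (rule tendsto_norm_zero)
qed

text \<open>
  The right-hand side has derivative \<open>Phi\<close>. For negative \<open>w\<close> this is the upper Mills bound
  \<open>Phi w \<le> phi w / \<bar>w\<bar>\<close>.
\<close>

lemma Mills_1: "0 \<le> w * Phi w + phi w"
proof (rule nonneg_of_deriv_nonneg_lim_at_bot[where G = "\<lambda>u. u * Phi u + phi u" and G' = Phi])
  show "((\<lambda>u. u * Phi u + phi u) has_real_derivative Phi u) (at u)" for u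
    by (auto intro!: derivative_eq_intros phi_has_derivative Phi_has_derivative)
  show "((\<lambda>u. u * Phi u + phi u) \<longlongrightarrow> 0) at_bot"
    using tendsto_add[OF times_Phi_tendsto_0[OF power_phi_tendsto_0(2)] power_phi_tendsto_0(1)] by simp
qed (rule Phi_nonneg)

text \<open>
  The derivative of the right-hand side is twice the expression of \<open>Mills_1\<close>. For negative \<open>w\<close> this is
  the lower Mills bound, which makes \<open>w * mills w\<close> monotone below.
\<close>

lemma Mills_2: "0 \<le> (1 + w\<^sup>2) * Phi w + w * phi w"
proof (rule nonneg_of_deriv_nonneg_lim_at_bot[where G = "\<lambda>u. (1 + u\<^sup>2) * Phi u + u * phi u" and G' = "\<lambda>u. 2 * (u * Phi u + phi u)"])
  show "((\<lambda>u. (1 + u\<^sup>2) * Phi u + u * phi u) has_real_derivative 2 * (u * Phi u + phi u)) (at u)" for u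
    by (auto intro!: derivative_eq_intros phi_has_derivative Phi_has_derivative
        simp: algebra_simps power2_eq_square)
  show "((\<lambda>u. (1 + u\<^sup>2) * Phi u + u * phi u) \<longlongrightarrow> 0) at_bot"
    using tendsto_add[OF tendsto_add[OF Phi_at_bot times_Phi_tendsto_0[OF power_phi_tendsto_0(3)]]
        power_phi_tendsto_0(2)] by (simp add: distrib_right)
  show "0 \<le> 2 * (u * Phi u + phi u)" for u
    by (intro mult_nonneg_nonneg Mills_1) simp
qed

definition mills :: "real \<Rightarrow> real" where "mills w = Phi w / phi w"

lemma mills_has_derivative: "(mills has_real_derivative 1 + w * mills w) (at w)"
  unfolding mills_def[abs_def]
  by (rule derivative_eq_intros phi_has_derivative Phi_has_derivative)+
     (use phi_pos[of w] in \<open>auto simp: field_simps power2_eq_square\<close>)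

lemma mills_nonneg: "0 \<le> mills w"
  unfolding mills_def using Phi_nonneg phi_pos[of w] by simp

lemma mills_ge: "-1 \<le> w * mills w"
  using Mills_1[of w] phi_pos[of w] by (simp add: mills_def field_simps)

lemma mills_mono: "u \<le> w \<Longrightarrow> mills u \<le> mills w"
proof (rule DERIV_nonneg_imp_nondecreasing[of u w mills])
  show "\<exists>y. (mills has_real_derivative y) (at x) \<and> 0 \<le> y" for x
    using mills_has_derivative[of x] mills_ge[of x] by (intro exI[of _ "1 + x * mills x"]) auto
qed

lemma times_mills_mono: "u \<le> w \<Longrightarrow> u * mills u \<le> w * mills w"
proof (rule DERIV_nonneg_imp_nondecreasing[of u w "\<lambda>x. x * mills x"])
  fix x
  have "((\<lambda>x. x * mills x) has_real_derivative mills x + x * (1 + x * mills x)) (at x)"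
    by (auto intro!: derivative_eq_intros mills_has_derivative)
  moreover have "0 \<le> mills x + x * (1 + x * mills x)"
    using Mills_2[of x] phi_pos[of x] by (simp add: mills_def field_simps power2_eq_square)
  ultimately show "\<exists>y. ((\<lambda>x. x * mills x) has_real_derivative y) (at x) \<and> 0 \<le> y" by blast
qed

text \<open>
  The two branches of the solution of Stein's equation agree at \<open>w = z\<close> by this identity.
\<close>

lemma mills_reflect: "mills w * (1 - Phi w) = mills (- w) * Phi w"
  by (simp add: mills_def Phi_minus std_normal_density_def)

lemma mills_0_le: "mills 0 \<le> 2"
proof -
  have "sqrt (2 * pi) \<le> sqrt 16" using pi_less_4 by (intro real_sqrt_le_mono) auto
  hence "sqrt (2 * pi) \<le> 4" by simp
  moreover have "Phi 0 = 1/2" using Phi_minus[of 0, simplified] by linarith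
  ultimately show ?thesis by (simp add: mills_def std_normal_density_def del: eq_divide_eq_numeral1)
qed

lemma Phi_mono: "u \<le> w \<Longrightarrow> Phi u \<le> Phi w"
  unfolding Phi_def by (rule std_normal.cdf_nondecreasing)

lemma mills_bound: "mills w * (1 - Phi w) \<le> 2"
proof (cases "w \<le> 0")
  case True
  have "mills w * (1 - Phi w) \<le> mills 0 * 1"
    using True Phi_nonneg Phi_le_1 by (intro mult_mono mills_mono mills_nonneg) auto
  thus ?thesis using mills_0_le by simp
next
  case False
  have "mills (- w) * Phi w \<le> mills 0 * 1"
    using False Phi_nonneg Phi_le_1 by (intro mult_mono mills_mono mills_nonneg) auto
  thus ?thesis using mills_0_le by (simp add: mills_reflect)
qed

text \<open>
  The bounded solution of Stein's equation for the indicator of \<open>{..z}\<close>.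
\<close>

definition stein :: "real \<Rightarrow> real \<Rightarrow> real" where
  "stein z w = (if w \<le> z then mills w * (1 - Phi z) else mills (- w) * Phi z)"

lemma stein_ge: "z \<le> w \<Longrightarrow> stein z w = mills (- w) * Phi z"
  by (auto simp: stein_def mills_reflect)

lemma stein_bound: "\<bar>stein z w\<bar> \<le> 2"
proof -
  have "0 \<le> stein z w"
    using mills_nonneg Phi_nonneg Phi_le_1 by (simp add: stein_def)
  moreover have "stein z w \<le> 2"
  proof (cases "w \<le> z")
    case True
    hence "mills w * (1 - Phi z) \<le> mills w * (1 - Phi w)"
      using mills_nonneg Phi_mono by (intro mult_left_mono) auto
    with True mills_bound[of w] show ?thesis by (simp add: stein_def)
  next
    case False
    hence "mills (-w) * Phi z \<le> mills (-w) * Phi w"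
      using mills_nonneg Phi_mono by (intro mult_left_mono) auto
    with False mills_bound[of "-w"] show ?thesis by (simp add: stein_def Phi_minus)
  qed
  ultimately show ?thesis by simp
qed

lemma times_stein_mono: "u \<le> w \<Longrightarrow> u * stein z u \<le> w * stein z w"
proof -
  have L: "u * stein z u \<le> w * stein z w" if "u \<le> w" "w \<le> z" for u w
    using that times_mills_mono[of u w] Phi_le_1[of z]
    by (auto simp: stein_def mult.assoc[symmetric] intro!: mult_right_mono)
  have R: "u * stein z u \<le> w * stein z w" if "u \<le> w" "z \<le> u" for u w
    using that times_mills_mono[of "-w" "-u"] Phi_nonneg[of z]
    by (auto simp: stein_ge mult.assoc[symmetric] intro!: mult_right_mono)
  assume "u \<le> w"
  thus ?thesis
    by (cases "w \<le> z"; cases "z \<le> u") (use L[of u w] R[of u w] L[of u z] R[of z w] in auto)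
qed

lemma times_stein_bound: "\<bar>w * stein z w\<bar> \<le> 1"
proof -
  have "-1 \<le> u * stein z u" if "u \<le> z" for u
  proof -
    have "- (1 - Phi z) \<le> (u * mills u) * (1 - Phi z)"
      using mult_right_mono[OF mills_ge[of u], of "1 - Phi z"] Phi_le_1[of z] by simp
    thus ?thesis using that Phi_nonneg[of z] by (simp add: stein_def mult.assoc)
  qed
  from this[of "min w z"] have "-1 \<le> w * stein z w"
    using times_stein_mono[of "min w z" w z] by simp
  moreover have "u * stein z u \<le> 1" if "z \<le> u" for u
  proof -
    have "- Phi z \<le> (-u * mills (-u)) * Phi z"
      using mult_right_mono[OF mills_ge[of "-u"], of "Phi z"] Phi_nonneg[of z] by simp
    thus ?thesis using that Phi_le_1[of z] by (simp add: stein_ge mult.assoc)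
  qed
  from this[of "max w z"] have "w * stein z w \<le> 1"
    using times_stein_mono[of w "max w z" z] by simp
  ultimately show ?thesis by simp
qed

text \<open>
  The derivative of \<open>stein z\<close> away from \<open>z\<close>. At \<open>z\<close>, where the derivative jumps, the value is the one that
  makes Stein's equation hold.
\<close>

definition stein' :: "real \<Rightarrow> real \<Rightarrow> real" where
  "stein' z w = w * stein z w + of_bool (w \<le> z) - Phi z"

lemma stein'_bound: "\<bar>stein' z w\<bar> \<le> 2"
  unfolding stein'_def using times_stein_bound[of w z] Phi_nonneg[of z] Phi_le_1[of z]
  by (auto simp: of_bool_def)

lemma stein_has_derivative:
  assumes "w \<noteq> z" shows "(stein z has_real_derivative stein' z w) (at w)"
proof (cases "w < z")
  case True
  have "((\<lambda>w. mills w * (1 - Phi z)) has_real_derivative stein' z w) (at w)"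
    using True by (auto intro!: derivative_eq_intros mills_has_derivative
        simp: stein'_def stein_def algebra_simps)
  thus ?thesis
    by (rule has_field_derivative_transform_within_open[of _ _ _ "{..<z}"])
       (use True in \<open>auto simp: stein_def\<close>)
next
  case False
  hence w: "z < w" using assms by simp
  have "((\<lambda>w. mills (- w) * Phi z) has_real_derivative stein' z w) (at w)"
    using w by (auto intro!: derivative_eq_intros DERIV_chain2[OF mills_has_derivative]
        simp: stein'_def stein_def algebra_simps)
  thus ?thesis
    by (rule has_field_derivative_transform_within_open[of _ _ _ "{z<..}"])
       (use w in \<open>auto simp: stein_def\<close>)
qed

lemma stein_continuous: "continuous_on A (stein z)"
proof -
  have "continuous_on ({..z} \<union> {z..}) (stein z)"
  proof (rule continuous_on_closed_Un)
    have "isCont mills w" for w using mills_has_derivative DERIV_isCont by blast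
    hence c: "continuous_on S mills" for S by (simp add: continuous_at_imp_continuous_on)
    show "continuous_on {..z} (stein z)"
      by (rule continuous_on_eq[OF continuous_on_mult_right[OF c, of _ "1 - Phi z"]])
         (simp add: stein_def)
    have "continuous_on {z..} (\<lambda>w. mills (- w))"
      by (rule continuous_on_compose2[OF c]) (auto intro!: continuous_intros)
    hence "continuous_on {z..} (\<lambda>w. mills (- w) * Phi z)"
      by (rule continuous_on_mult_right)
    thus "continuous_on {z..} (stein z)"
      by (rule continuous_on_eq) (simp add: stein_ge)
  qed auto
  moreover have "{..z} \<union> {z..} = UNIV" by auto
  ultimately show ?thesis by (metis continuous_on_subset subset_UNIV)
qed

text \<open>
  The derivative \<open>stein' z\<close> is a nondecreasing term plus a nonincreasing indicator. Changing the sign of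
  the indicator gives a nondecreasing function whose increments bound the oscillation of \<open>stein' z\<close>.
\<close>

definition stein_mono :: "real \<Rightarrow> real \<Rightarrow> real" where
  "stein_mono z w = w * stein z w - of_bool (w \<le> z)"

lemma stein_mono_bound: "\<bar>stein_mono z w\<bar> \<le> 2"
  unfolding stein_mono_def using times_stein_bound[of w z] by (auto simp: of_bool_def)

lemma stein'_diff: "u \<le> w \<Longrightarrow> u \<le> x \<Longrightarrow> x \<le> w \<Longrightarrow> u \<le> y \<Longrightarrow> y \<le> w \<Longrightarrow>
  \<bar>stein' z x - stein' z y\<bar> \<le> stein_mono z w - stein_mono z u"
  using times_stein_mono[of u x z] times_stein_mono[of x w z]
    times_stein_mono[of u y z] times_stein_mono[of y w z]
  unfolding stein'_def stein_mono_def by (auto simp: of_bool_def abs_if)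

text \<open>
  The mean value theorem applies on an interval that does not have the kink \<open>z\<close> in its interior.
\<close>

lemma stein_increment_aux:
  assumes "u \<le> w" "u \<le> y" "y \<le> w" "u \<le> s" "s \<le> t" "t \<le> w" "t \<le> z \<or> z \<le> s"
  shows "\<bar>stein z t - stein z s - (t - s) * stein' z y\<bar> \<le> (t - s) * (stein_mono z w - stein_mono z u)"
proof (cases "s = t")
  case False
  hence st: "s < t" using assms by simp
  have "\<exists>x. s < x \<and> x < t \<and> stein z t - stein z s = (t - s) * stein' z x"
  proof -
    have "\<exists>l x. s < x \<and> x < t \<and> (stein z has_real_derivative l) (at x) \<and>
        stein z t - stein z s = (t - s) * l"
      using assms(7) by (intro MVT[OF st stein_continuous])
        (auto simp: real_differentiable_def intro!: exI stein_has_derivative)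
    then obtain l x where x: "s < x" "x < t" "(stein z has_real_derivative l) (at x)"
      "stein z t - stein z s = (t - s) * l" by blast
    moreover have "l = stein' z x"
      using x assms(7) by (intro DERIV_unique[OF x(3)] stein_has_derivative) auto
    ultimately show ?thesis by blast
  qed
  then obtain x where x: "s < x" "x < t" "stein z t - stein z s = (t - s) * stein' z x" by blast
  have "\<bar>stein z t - stein z s - (t - s) * stein' z y\<bar> = (t - s) * \<bar>stein' z x - stein' z y\<bar>"
    using st by (simp add: x(3) abs_mult flip: right_diff_distrib)
  also have "\<dots> \<le> (t - s) * (stein_mono z w - stein_mono z u)"
    using assms x st by (intro mult_left_mono stein'_diff) auto
  finally show ?thesis .
qed simp

text \<open>
  An interval around the kink is cut at \<open>z\<close>.
\<close>

lemma stein_increment_ord: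
  assumes "u \<le> w" "u \<le> y" "y \<le> w"
  shows "\<bar>stein z w - stein z u - (w - u) * stein' z y\<bar> \<le> (w - u) * (stein_mono z w - stein_mono z u)"
proof (cases "w \<le> z \<or> z \<le> u")
  case True thus ?thesis using assms by (intro stein_increment_aux) auto
next
  case False
  have "\<bar>stein z w - stein z z - (w - z) * stein' z y\<bar> \<le> (w - z) * (stein_mono z w - stein_mono z u)"
    using assms False by (intro stein_increment_aux) auto
  moreover have "\<bar>stein z z - stein z u - (z - u) * stein' z y\<bar> \<le> (z - u) * (stein_mono z w - stein_mono z u)"
    using assms False by (intro stein_increment_aux) auto
  ultimately have "\<bar>(stein z w - stein z z - (w - z) * stein' z y) + (stein z z - stein z u - (z - u) * stein' z y)\<bar>
     \<le> (w - z) * (stein_mono z w - stein_mono z u) + (z - u) * (stein_mono z w - stein_mono z u)"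
    by linarith
  thus ?thesis by (simp add: algebra_simps)
qed

text \<open>
  The sign of \<open>t - s\<close> is that of the increment of \<open>stein_mono z\<close>, so the bound is symmetric in \<open>s\<close> and \<open>t\<close>.
  This form has no absolute value around the increment, and an exchangeable pair can therefore be
  swapped inside its expectation.
\<close>

lemma stein_increment:
  "\<bar>(t - s) * (stein z t - stein z s) - (t - s)\<^sup>2 * stein' z t\<bar>
     \<le> \<bar>t - s\<bar> * (t - s) * (stein_mono z t - stein_mono z s)"
proof -
  have *: "(t - s) * (stein z t - stein z s) - (t - s)\<^sup>2 * stein' z t
      = (t - s) * (stein z t - stein z s - (t - s) * stein' z t)"
    by (simp add: algebra_simps power2_eq_square)
  show ?thesis
  proof (cases "s \<le> t")
    case True
    show ?thesis
      using mult_left_mono[OF stein_increment_ord[of s t t z], of "t - s"] True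
      unfolding * by (simp add: abs_mult mult.assoc)
  next
    case False
    have "\<bar>stein z t - stein z s - (t - s) * stein' z t\<bar> = \<bar>stein z s - stein z t - (s - t) * stein' z t\<bar>"
      by (simp add: abs_if algebra_simps)
    hence "\<bar>stein z t - stein z s - (t - s) * stein' z t\<bar> \<le> (s - t) * (stein_mono z s - stein_mono z t)"
      using stein_increment_ord[of t s t z] False by simp
    hence "\<bar>t - s\<bar> * \<bar>stein z t - stein z s - (t - s) * stein' z t\<bar>
        \<le> \<bar>t - s\<bar> * ((s - t) * (stein_mono z s - stein_mono z t))"
      by (rule mult_left_mono) simp
    also have "(s - t) * (stein_mono z s - stein_mono z t) = (t - s) * (stein_mono z t - stein_mono z s)"
      by (simp add: algebra_simps)
    finally show ?thesis
      unfolding * abs_mult by (simp only: mult.assoc)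
  qed
qed

lemma stein_equation: "stein' z w - w * stein z w = of_bool (w \<le> z) - Phi z"
  by (simp add: stein'_def)

section \<open>Finite product spaces and the Efron--Stein inequality\<close>

lemma expectation_swap_finite:
  fixes f :: "'a \<Rightarrow> 'b \<Rightarrow> real"
  assumes "finite (set_pmf p)" "finite (set_pmf q)"
  shows "measure_pmf.expectation p (\<lambda>x. measure_pmf.expectation q (f x)) =
    measure_pmf.expectation q (\<lambda>y. measure_pmf.expectation p (\<lambda>x. f x y))"
proof -
  have "measure_pmf.expectation p (\<lambda>x. measure_pmf.expectation q (f x)) =
      (\<Sum>x\<in>set_pmf p. \<Sum>y\<in>set_pmf q. f x y * pmf q y * pmf p x)"
    using assms by (subst integral_measure_pmf_real[of "set_pmf p"])
      (auto simp: integral_measure_pmf_real[of "set_pmf q"] sum_distrib_right)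
  also have "\<dots> = (\<Sum>y\<in>set_pmf q. \<Sum>x\<in>set_pmf p. f x y * pmf p x * pmf q y)"
    by (subst sum.swap) (simp add: mult_ac)
  also have "\<dots> = measure_pmf.expectation q (\<lambda>y. measure_pmf.expectation p (\<lambda>x. f x y))"
    using assms by (subst integral_measure_pmf_real[of "set_pmf q"])
      (auto simp: integral_measure_pmf_real[of "set_pmf p"] sum_distrib_right)
  finally show ?thesis .
qed

locale finite_product =
  fixes I :: "'i set" and p :: "'i \<Rightarrow> 'a pmf" and d :: 'a
  assumes finite_I: "finite I" and finite_p: "\<And>i. finite (set_pmf (p i))"
begin

abbreviation joint where "joint \<equiv> Pi_pmf I d p"
abbreviation expect :: "(('i \<Rightarrow> 'a) \<Rightarrow> real) \<Rightarrow> real" where "expect F \<equiv> measure_pmf.expectation joint F"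

definition cond_mean :: "'i \<Rightarrow> (('i \<Rightarrow> 'a) \<Rightarrow> real) \<Rightarrow> ('i \<Rightarrow> 'a) \<Rightarrow> real" where
  "cond_mean i F x = measure_pmf.expectation (p i) (\<lambda>y. F (x(i := y)))"

definition dev :: "'i \<Rightarrow> (('i \<Rightarrow> 'a) \<Rightarrow> real) \<Rightarrow> ('i \<Rightarrow> 'a) \<Rightarrow> real" where
  "dev i F x = F x - cond_mean i F x"

lemma finite_joint: "finite (set_pmf joint)"
  using finite_I finite_p by (auto simp: set_Pi_pmf)

lemma integrable_joint [simp]: "integrable (measure_pmf joint) (F :: _ \<Rightarrow> real)"
  by (rule integrable_measure_pmf_finite[OF finite_joint])

lemma integrable_p [simp]: "integrable (measure_pmf (p i)) (F :: _ \<Rightarrow> real)"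
  by (rule integrable_measure_pmf_finite[OF finite_p])

lemma expect_mono: "(\<And>x. F x \<le> G x) \<Longrightarrow> expect F \<le> expect G"
  by (intro integral_mono) auto

lemma expect_split:
  assumes "i \<in> I"
  shows "expect F = measure_pmf.expectation (p i) (\<lambda>y.
    measure_pmf.expectation (Pi_pmf (I - {i}) d p) (\<lambda>f. F (f(i := y))))"
proof -
  have "joint = Pi_pmf (insert i (I - {i})) d p" using assms by (simp add: insert_absorb)
  also have "\<dots> = bind_pmf (p i) (\<lambda>y. map_pmf (\<lambda>f. f(i := y)) (Pi_pmf (I - {i}) d p))"
    using finite_I by (subst Pi_pmf_insert') (auto simp: map_pmf_def)
  finally have "expect F = measure_pmf.expectation
      (bind_pmf (p i) (\<lambda>y. map_pmf (\<lambda>f. f(i := y)) (Pi_pmf (I - {i}) d p))) F" by simp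
  also have "\<dots> = measure_pmf.expectation (p i) (\<lambda>y.
      measure_pmf.expectation (Pi_pmf (I - {i}) d p) (\<lambda>f. F (f(i := y))))"
    using finite_I finite_p
    by (subst pmf_expectation_bind[of "set_pmf (p i)"])
       (auto simp: set_Pi_pmf integral_measure_pmf_real[of "set_pmf (p i)"] mult.commute
         intro!: finite_imageI)
  finally show ?thesis .
qed

text \<open>
  The configurations before and after resampling letter \<open>i\<close> form an exchangeable pair: given the other
  letters, they carry two independent draws from \<open>p i\<close>.
\<close>

lemma expect_pair_swap:
  assumes "i \<in> I"
  shows "expect (\<lambda>x. measure_pmf.expectation (p i) (\<lambda>y. G x (x(i := y)))) =
         expect (\<lambda>x. measure_pmf.expectation (p i) (\<lambda>y. G (x(i := y)) x))"
proof -
  have fin: "finite (set_pmf (Pi_pmf (I - {i}) d p))"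
    using finite_I finite_p by (auto simp: set_Pi_pmf)
  let ?E = "measure_pmf.expectation (p i)" and ?E' = "measure_pmf.expectation (Pi_pmf (I - {i}) d p)"
  have "expect (\<lambda>x. ?E (\<lambda>y. G x (x(i := y)))) = ?E (\<lambda>y'. ?E' (\<lambda>f. ?E (\<lambda>y. G (f(i := y')) (f(i := y)))))"
    by (subst expect_split[OF assms]) simp
  also have "\<dots> = ?E (\<lambda>y'. ?E (\<lambda>y. ?E' (\<lambda>f. G (f(i := y')) (f(i := y)))))"
    by (subst expectation_swap_finite[OF fin finite_p]) simp
  also have "\<dots> = ?E (\<lambda>y. ?E (\<lambda>y'. ?E' (\<lambda>f. G (f(i := y')) (f(i := y)))))"
    by (rule expectation_swap_finite[OF finite_p finite_p])
  also have "\<dots> = ?E (\<lambda>y. ?E' (\<lambda>f. ?E (\<lambda>y'. G (f(i := y')) (f(i := y)))))"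
    by (subst expectation_swap_finite[OF fin finite_p]) simp
  also have "\<dots> = expect (\<lambda>x. ?E (\<lambda>y. G (x(i := y)) x))"
    by (subst expect_split[OF assms]) simp
  finally show ?thesis .
qed

lemma cond_mean_adjoint: "i \<in> I \<Longrightarrow> expect (\<lambda>x. cond_mean i F x * G x) = expect (\<lambda>x. F x * cond_mean i G x)"
  using expect_pair_swap[of i "\<lambda>x x'. F x' * G x"] by (simp add: cond_mean_def)

lemma expect_cond_mean: "i \<in> I \<Longrightarrow> expect (cond_mean i F) = expect F"
  using expect_pair_swap[of i "\<lambda>x x'. F x'"] by (simp add: cond_mean_def[abs_def])

lemma cond_mean_upd: "cond_mean i F (x(i := y)) = cond_mean i F x"
  by (simp add: cond_mean_def)

lemma cond_mean_idem: "cond_mean i (cond_mean i F) = cond_mean i F"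
  by (rule ext) (simp add: cond_mean_def)

lemma cond_mean_commute: "cond_mean i (cond_mean j F) = cond_mean j (cond_mean i F)"
proof (cases "i = j")
  case False
  show ?thesis
    unfolding cond_mean_def
    by (rule ext, subst expectation_swap_finite[OF finite_p finite_p])
       (simp add: fun_upd_twist[OF False])
qed simp

lemma cond_mean_diff: "cond_mean i (\<lambda>x. F x - G x) x = cond_mean i F x - cond_mean i G x"
  by (simp add: cond_mean_def)

lemma dev_idem: "dev i (dev i F) = dev i F"
  by (rule ext) (simp add: dev_def[abs_def] cond_mean_diff cond_mean_idem)

lemma dev_commute: "dev i (dev j F) = dev j (dev i F)"
  by (rule ext) (simp add: dev_def[abs_def] cond_mean_diff cond_mean_commute[of i j])

lemma dev_adjoint: "i \<in> I \<Longrightarrow> expect (\<lambda>x. dev i F x * G x) = expect (\<lambda>x. F x * dev i G x)"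
  using cond_mean_adjoint[of i F G] by (simp add: dev_def left_diff_distrib right_diff_distrib)

lemma dev_project: "i \<in> I \<Longrightarrow> expect (\<lambda>x. dev i F x * G x) = expect (\<lambda>x. dev i F x * dev i G x)"
  using dev_adjoint[of i "dev i F" G] by (simp add: dev_idem)

text \<open>
  The operators \<open>dev i\<close> are commuting self-adjoint projections, so a mixed inner product only sees the
  part of \<open>F\<close> that depends on both coordinates.
\<close>

lemma dev_inner_dev:
  assumes "i \<in> I" "j \<in> I"
  shows "expect (\<lambda>x. dev i F x * dev j F x) = expect (\<lambda>x. (dev i (dev j F) x)\<^sup>2)"
proof -
  have "expect (\<lambda>x. dev i F x * dev j F x) = expect (\<lambda>x. dev j (dev i F) x * dev i F x)"
    using dev_project[OF assms(1), of F "dev j F"] by (simp add: dev_commute[of i j] mult.commute)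
  also have "\<dots> = expect (\<lambda>x. dev j (dev i F) x * dev j (dev i F) x)"
    by (rule dev_project[OF assms(2)])
  finally show ?thesis by (simp add: dev_commute[of i j] power2_eq_square)
qed

text \<open>
  The conditional mean given all letters outside the list.
\<close>

definition cond_means :: "'i list \<Rightarrow> (('i \<Rightarrow> 'a) \<Rightarrow> real) \<Rightarrow> ('i \<Rightarrow> 'a) \<Rightarrow> real" where
  "cond_means is F = foldr cond_mean is F"

lemma cond_means_simps: "cond_means [] F = F" "cond_means (i # is) F = cond_mean i (cond_means is F)"
  by (simp_all add: cond_means_def)

lemma cond_means_upd: "i \<in> set is \<Longrightarrow> cond_means is F (x(i := y)) = cond_means is F x"
proof (induction "is" arbitrary: x)
  case (Cons j js)
  show ?case
  proof (cases "i = j")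
    case False
    thus ?thesis using Cons by (simp add: cond_means_simps cond_mean_def fun_upd_twist[OF False] del: fun_upd_apply)
  qed (simp only: cond_means_simps cond_mean_upd not_not)
qed simp

text \<open>
  Two configurations that differ in finitely many coordinates are linked by changing one at a time.
\<close>

lemma invariant_eqI:
  assumes "finite J" "\<And>i x y. i \<in> J \<Longrightarrow> G (x(i := y)) = G x" "\<And>i. i \<notin> J \<Longrightarrow> x i = x' i"
  shows "G x = G x'"
  using assms
proof (induction J arbitrary: x rule: finite_induct)
  case empty
  hence "x = x'" by auto
  thus ?case by simp
next
  case (insert j J)
  have "G (x(j := x' j)) = G x'"
  proof (rule insert.IH)
    show "G (x(i := y)) = G x" if "i \<in> J" for i x y
      using that by (intro insert.prems(1)) simp
    show "(x(j := x' j)) i = x' i" if "i \<notin> J" for i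
      using that insert.prems(2)[of i] by (cases "i = j") simp_all
  qed
  moreover have "G (x(j := x' j)) = G x" by (rule insert.prems(1)) simp
  ultimately show ?case by simp
qed

lemma expect_cond_means: "set is \<subseteq> I \<Longrightarrow> expect (cond_means is F) = expect F"
  by (induction "is") (simp_all add: cond_means_simps expect_cond_mean)

lemma cond_means_eq_expect:
  assumes "set is = I" "x \<in> set_pmf joint"
  shows "cond_means is F x = expect F"
proof -
  have "expect F = expect (cond_means is F)" using assms by (simp add: expect_cond_means)
  also have "\<dots> = expect (\<lambda>_. cond_means is F x)"
  proof (intro integral_cong_AE, simp_all add: AE_measure_pmf_iff, intro ballI)
    fix y assume y: "y \<in> set_pmf joint"
    show "cond_means is F y = cond_means is F x"
    proof (rule invariant_eqI[OF finite_I, where G = "cond_means is F"])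
      show "cond_means is F (z(i := w)) = cond_means is F z" if "i \<in> I" for i z w
        using that assms by (simp add: cond_means_upd)
      show "y i = x i" if "i \<notin> I" for i
        using that y assms finite_I by (simp add: set_Pi_pmf PiE_dflt_def)
    qed
  qed
  finally show ?thesis by simp
qed

lemma cond_mean_sq_le: "i \<in> I \<Longrightarrow> expect (\<lambda>x. (cond_mean i F x)\<^sup>2) \<le> expect (\<lambda>x. (F x)\<^sup>2)"
proof -
  assume i: "i \<in> I"
  have "expect (\<lambda>x. (cond_mean i F x)\<^sup>2) = expect (\<lambda>x. F x * cond_mean i F x)"
    using cond_mean_adjoint[OF i, of F "cond_mean i F"] by (simp add: cond_mean_idem power2_eq_square)
  moreover have "0 \<le> expect (\<lambda>x. (F x - cond_mean i F x)\<^sup>2)" by (intro integral_nonneg_AE) auto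
  ultimately show ?thesis by (simp add: power2_diff mult.assoc)
qed

text \<open>
  The step from \<open>js\<close> to \<open>i # js\<close> adds \<open>dev i F\<close>, which is orthogonal to the image of \<open>cond_mean i\<close>, while
  \<open>cond_mean i\<close> contracts the old error.
\<close>

lemma cond_means_diff_sq_le:
  assumes "set is \<subseteq> I"
  shows "expect (\<lambda>x. (F x - cond_means is F x)\<^sup>2) \<le> (\<Sum>i\<leftarrow>is. expect (\<lambda>x. (dev i F x)\<^sup>2))"
  using assms
proof (induction "is")
  case (Cons i js)
  define G where "G = (\<lambda>x. F x - cond_means js F x)"
  have i: "i \<in> I" using Cons by simp
  have G: "cond_mean i G x = cond_mean i F x - cond_mean i (cond_means js F) x" for x
    unfolding G_def by (rule cond_mean_diff)
  have orth: "expect (\<lambda>x. dev i F x * cond_mean i G x) = 0"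
    using dev_adjoint[OF i, of F "cond_mean i G"] by (simp add: dev_def[abs_def] cond_mean_idem)
  have "expect (\<lambda>x. (F x - cond_means (i # js) F x)\<^sup>2) = expect (\<lambda>x. (dev i F x + cond_mean i G x)\<^sup>2)"
    by (simp add: cond_means_simps dev_def G)
  also have "\<dots> = expect (\<lambda>x. (dev i F x)\<^sup>2) + expect (\<lambda>x. (cond_mean i G x)\<^sup>2)"
    using orth by (simp add: power2_sum mult.assoc)
  also have "\<dots> \<le> expect (\<lambda>x. (dev i F x)\<^sup>2) + expect (\<lambda>x. (G x)\<^sup>2)"
    using cond_mean_sq_le[OF i] by simp
  finally show ?case using Cons by (simp add: G_def)
qed (simp add: cond_means_simps)

theorem Efron_Stein: "expect (\<lambda>x. (F x - expect F)\<^sup>2) \<le> (\<Sum>i\<in>I. expect (\<lambda>x. (dev i F x)\<^sup>2))"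
proof -
  obtain js where js: "set js = I" "distinct js" using finite_distinct_list[OF finite_I] by auto
  have "expect (\<lambda>x. (F x - expect F)\<^sup>2) = expect (\<lambda>x. (F x - cond_means js F x)\<^sup>2)"
    by (intro integral_cong_AE) (auto simp: AE_measure_pmf_iff cond_means_eq_expect[OF js(1)])
  also have "\<dots> \<le> (\<Sum>i\<leftarrow>js. expect (\<lambda>x. (dev i F x)\<^sup>2))"
    using js by (intro cond_means_diff_sq_le) auto
  also have "\<dots> = (\<Sum>i\<in>I. expect (\<lambda>x. (dev i F x)\<^sup>2))"
    using js by (simp add: sum_list_distinct_conv_sum_set)
  finally show ?thesis .
qed

text \<open>
  In the Hoeffding decomposition, \<open>\<Sum>i\<in>I. dev i F\<close> multiplies a component depending on \<open>m\<close> letters by \<open>m\<close>.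
  The left-hand side thus measures the nonlinear part of a centred \<open>F\<close>. Read with the
  Efron--Stein inequality, the identity bounds it by mixed deviations; read as nonnegativity of
  the right-hand side, it bounds the variance from below.
\<close>

lemma expect_sum_dev_minus_sq:
  "expect (\<lambda>x. ((\<Sum>i\<in>I. dev i F x) - F x)\<^sup>2) =
     expect (\<lambda>x. (F x)\<^sup>2) - (\<Sum>i\<in>I. expect (\<lambda>x. (dev i F x)\<^sup>2))
     + (\<Sum>i\<in>I. \<Sum>j\<in>I - {i}. expect (\<lambda>x. (dev i (dev j F) x)\<^sup>2))"
proof -
  have "expect (\<lambda>x. ((\<Sum>i\<in>I. dev i F x) - F x)\<^sup>2)
     = expect (\<lambda>x. (\<Sum>i\<in>I. \<Sum>j\<in>I. dev i F x * dev j F x) - 2 * (\<Sum>i\<in>I. dev i F x * F x) + (F x)\<^sup>2)"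
  proof (intro arg_cong[where f = expect] ext)
    fix x
    have "((\<Sum>i\<in>I. dev i F x) - F x)\<^sup>2
        = (\<Sum>i\<in>I. dev i F x) * (\<Sum>i\<in>I. dev i F x) - 2 * ((\<Sum>i\<in>I. dev i F x) * F x) + (F x)\<^sup>2"
      by (simp add: power2_eq_square algebra_simps)
    thus "((\<Sum>i\<in>I. dev i F x) - F x)\<^sup>2
        = (\<Sum>i\<in>I. \<Sum>j\<in>I. dev i F x * dev j F x) - 2 * (\<Sum>i\<in>I. dev i F x * F x) + (F x)\<^sup>2"
      by (simp add: sum_product[symmetric] sum_distrib_right[symmetric])
  qed
  also have "\<dots> = (\<Sum>i\<in>I. \<Sum>j\<in>I. expect (\<lambda>x. dev i F x * dev j F x))
      - 2 * (\<Sum>i\<in>I. expect (\<lambda>x. dev i F x * F x)) + expect (\<lambda>x. (F x)\<^sup>2)"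
    by simp
  also have "(\<Sum>i\<in>I. expect (\<lambda>x. dev i F x * F x)) = (\<Sum>i\<in>I. expect (\<lambda>x. (dev i F x)\<^sup>2))"
    by (intro sum.cong refl) (simp add: dev_project[of _ F F] power2_eq_square)
  also have "(\<Sum>i\<in>I. \<Sum>j\<in>I. expect (\<lambda>x. dev i F x * dev j F x)) =
      (\<Sum>i\<in>I. expect (\<lambda>x. (dev i F x)\<^sup>2) + (\<Sum>j\<in>I - {i}. expect (\<lambda>x. (dev i (dev j F) x)\<^sup>2)))"
    using finite_I
    by (intro sum.cong refl, subst sum.remove[of I])
       (auto simp: dev_inner_dev dev_idem intro!: sum.cong)
  finally show ?thesis by (simp add: sum.distrib)
qed

lemma expect_abs_le_sqrt: "expect (\<lambda>x. \<bar>F x\<bar>) \<le> sqrt (expect (\<lambda>x. (F x)\<^sup>2))"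
proof -
  let ?m = "expect (\<lambda>x. \<bar>F x\<bar>)"
  have "0 \<le> expect (\<lambda>x. (\<bar>F x\<bar> - ?m)\<^sup>2)" by (intro integral_nonneg_AE) auto
  also have "\<dots> = expect (\<lambda>x. (F x)\<^sup>2) - ?m\<^sup>2"
    by (simp add: power2_diff) (simp add: power2_eq_square)
  finally show ?thesis by (intro real_le_rsqrt) simp
qed

lemma expectation_bound:
  assumes "\<And>y. \<bar>f y\<bar> \<le> (c::real)"
  shows "\<bar>measure_pmf.expectation (p i) f\<bar> \<le> c"
proof -
  have "\<bar>measure_pmf.expectation (p i) f\<bar> \<le> measure_pmf.expectation (p i) (\<lambda>y. \<bar>f y\<bar>)"
    by (rule integral_abs_bound)
  also have "\<dots> \<le> measure_pmf.expectation (p i) (\<lambda>_. c)"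
    using assms by (intro integral_mono) auto
  finally show ?thesis by simp
qed

lemma dev_eq: "dev i F x = measure_pmf.expectation (p i) (\<lambda>y. F x - F (x(i := y)))"
  by (simp add: dev_def cond_mean_def)

lemma dev_bound: "(\<And>y. \<bar>F x - F (x(i := y))\<bar> \<le> c) \<Longrightarrow> \<bar>dev i F x\<bar> \<le> c"
  unfolding dev_eq by (rule expectation_bound)

lemma dev_dev_bound:
  assumes "i \<noteq> j" "\<And>y w. \<bar>F x - F (x(i := y)) - F (x(j := w)) + F (x(i := y, j := w))\<bar> \<le> c"
  shows "\<bar>dev i (dev j F) x\<bar> \<le> c"
proof (rule dev_bound)
  fix y
  have "dev j F x - dev j F (x(i := y)) = dev j (\<lambda>x. F x - F (x(i := y))) x"
    by (simp add: dev_eq fun_upd_twist[OF assms(1)] algebra_simps)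
  also have "\<bar>\<dots>\<bar> \<le> c"
    using assms(2)[of y] by (intro dev_bound) (simp add: fun_upd_twist[OF assms(1)] algebra_simps)
  finally show "\<bar>dev j F x - dev j F (x(i := y))\<bar> \<le> c" .
qed

lemma expect_sq_bound:
  assumes "\<And>x. \<bar>F x\<bar> \<le> c" shows "expect (\<lambda>x. (F x)\<^sup>2) \<le> c\<^sup>2"
proof -
  have "(F x)\<^sup>2 \<le> c\<^sup>2" for x
    using power_mono[OF assms[of x], of 2] by simp
  from expect_mono[OF this] show ?thesis by simp
qed

lemma expect_abs_deviation_bound:
  assumes "\<And>i x y. i \<in> I \<Longrightarrow> \<bar>F x - F (x(i := y))\<bar> \<le> c" "0 \<le> c"
  shows "expect (\<lambda>x. \<bar>F x - expect F\<bar>) \<le> sqrt (card I) * c"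
proof -
  have "expect (\<lambda>x. (F x - expect F)\<^sup>2) \<le> (\<Sum>i\<in>I. expect (\<lambda>x. (dev i F x)\<^sup>2))" by (rule Efron_Stein)
  also have "\<dots> \<le> (\<Sum>i\<in>I. c\<^sup>2)"
    by (intro sum_mono expect_sq_bound dev_bound assms)
  finally have "sqrt (expect (\<lambda>x. (F x - expect F)\<^sup>2)) \<le> sqrt (card I * c\<^sup>2)" by simp
  also have "\<dots> = sqrt (card I) * c" using assms(2) by (simp add: real_sqrt_mult)
  finally show ?thesis using expect_abs_le_sqrt[of "\<lambda>x. F x - expect F"] by linarith
qed

end

section \<open>A Berry--Esseen bound from first and second differences\<close>

lemma signed_square_diff: "\<bar>s * \<bar>s\<bar> - t * \<bar>t\<bar>\<bar> \<le> \<bar>s - t\<bar> * (\<bar>s\<bar> + \<bar>t\<bar>)" for s t :: real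
proof -
  have "s * \<bar>s\<bar> - t * \<bar>t\<bar> = (s - t) * \<bar>s\<bar> + t * (\<bar>s\<bar> - \<bar>t\<bar>)" by (simp add: algebra_simps)
  also have "\<bar>\<dots>\<bar> \<le> \<bar>s - t\<bar> * \<bar>s\<bar> + \<bar>t\<bar> * \<bar>\<bar>s\<bar> - \<bar>t\<bar>\<bar>"
    by (rule order_trans[OF abs_triangle_ineq]) (simp add: abs_mult)
  also have "\<dots> \<le> \<bar>s - t\<bar> * \<bar>s\<bar> + \<bar>t\<bar> * \<bar>s - t\<bar>"
    by (intro add_left_mono mult_left_mono abs_triangle_ineq3) auto
  finally show ?thesis by (simp add: algebra_simps)
qed

lemma square_diff: "\<bar>s\<^sup>2 - t\<^sup>2\<bar> \<le> \<bar>s - t\<bar> * (\<bar>s\<bar> + \<bar>t\<bar>)" for s t :: real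
proof -
  have "s\<^sup>2 - t\<^sup>2 = (s - t) * (s + t)" by (simp add: power2_eq_square algebra_simps)
  thus ?thesis by (simp add: abs_mult mult_left_mono abs_triangle_ineq)
qed

context finite_product
begin

abbreviation expect_pair :: "'i \<Rightarrow> (('i \<Rightarrow> 'a) \<Rightarrow> ('i \<Rightarrow> 'a) \<Rightarrow> real) \<Rightarrow> real" where
  "expect_pair i G \<equiv> expect (\<lambda>x. measure_pmf.expectation (p i) (\<lambda>y. G x (x(i := y))))"

lemma expect_pair_mono: "(\<And>x x'. G x x' \<le> H x x') \<Longrightarrow> expect_pair i G \<le> expect_pair i H"
  by (intro integral_mono) auto

lemma expect_pair_abs: "\<bar>expect_pair i G\<bar> \<le> expect_pair i (\<lambda>x x'. \<bar>G x x'\<bar>)"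
proof (rule order_trans[OF integral_abs_bound], rule expect_mono)
  show "\<bar>measure_pmf.expectation (p i) (\<lambda>y. G x (x(i := y)))\<bar>
      \<le> measure_pmf.expectation (p i) (\<lambda>y. \<bar>G x (x(i := y))\<bar>)" for x
    by (rule integral_abs_bound)
qed

lemma expect_pair_antisym:
  assumes "i \<in> I" "\<And>x x'. G x' x = - G x x'" shows "expect_pair i G = 0"
proof -
  have "expect_pair i G = expect_pair i (\<lambda>x x'. - G x x')"
    unfolding expect_pair_swap[OF assms(1), of G] by (subst assms(2)) (rule refl)
  thus ?thesis by simp
qed

lemma expect_dev_times:
  assumes "i \<in> I"
  shows "expect (\<lambda>x. dev i F x * f (F x)) = expect_pair i (\<lambda>x x'. (F x - F x') * (f (F x) - f (F x'))) / 2"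
proof -
  have "expect (\<lambda>x. dev i F x * f (F x)) = expect_pair i (\<lambda>x x'. (F x - F x') * f (F x))"
    by (simp add: dev_eq)
  moreover have "\<dots> = expect_pair i (\<lambda>x x'. (F x' - F x) * f (F x'))"
    by (rule expect_pair_swap[OF assms])
  moreover have "expect_pair i (\<lambda>x x'. (F x - F x') * (f (F x) - f (F x'))) =
      expect_pair i (\<lambda>x x'. (F x - F x') * f (F x) + (F x' - F x) * f (F x'))"
    by (simp add: algebra_simps)
  ultimately show ?thesis by simp
qed

lemma expect_dev_sq: "i \<in> I \<Longrightarrow> expect (\<lambda>x. (dev i F x)\<^sup>2) = expect_pair i (\<lambda>x x'. (F x - F x')\<^sup>2) / 2"
  using expect_dev_times[of i F "\<lambda>t. t"] dev_project[of i F F] by (simp add: power2_eq_square)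

text \<open>
  The Taylor error of \<open>stein_increment\<close> is symmetric in the exchangeable pair, so its expectation equals
  twice the one with the increment of \<open>stein_mono z\<close> replaced by its value at the first component.
  There the draw of the new letter can be averaged first.
\<close>

lemma stein_exchangeable:
  assumes "i \<in> I"
  shows "\<bar>expect (\<lambda>x. dev i F x * stein z (F x))
     - expect (\<lambda>x. measure_pmf.expectation (p i) (\<lambda>y. (F x - F (x(i := y)))\<^sup>2) * stein' z (F x)) / 2\<bar>
   \<le> expect (\<lambda>x. measure_pmf.expectation (p i) (\<lambda>y. (F x - F (x(i := y))) * \<bar>F x - F (x(i := y))\<bar>)
        * stein_mono z (F x))"
proof -
  let ?d = "\<lambda>x x'. F x - F x'" and ?r = "\<lambda>x. stein_mono z (F x)"
  have "\<bar>expect_pair i (\<lambda>x x'. ?d x x' * (stein z (F x) - stein z (F x')) - (?d x x')\<^sup>2 * stein' z (F x))\<bar>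
      \<le> expect_pair i (\<lambda>x x'. \<bar>?d x x' * (stein z (F x) - stein z (F x')) - (?d x x')\<^sup>2 * stein' z (F x)\<bar>)"
    by (rule expect_pair_abs)
  also have "\<dots> \<le> expect_pair i (\<lambda>x x'. \<bar>?d x x'\<bar> * ?d x x' * (?r x - ?r x'))"
    by (intro expect_pair_mono stein_increment)
  also have "\<dots> = expect_pair i (\<lambda>x x'. \<bar>?d x x'\<bar> * ?d x x' * ?r x + \<bar>?d x' x\<bar> * ?d x' x * ?r x')"
    by (simp add: algebra_simps abs_minus_commute)
  also have "\<dots> = 2 * expect_pair i (\<lambda>x x'. \<bar>?d x x'\<bar> * ?d x x' * ?r x)"
    using expect_pair_swap[OF assms, of "\<lambda>x x'. \<bar>?d x x'\<bar> * ?d x x' * ?r x"] by simp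
  finally show ?thesis
    unfolding expect_dev_times[OF assms, of F "stein z"] by (simp add: mult.commute)
qed

text \<open>
  The error splits into the fluctuation of the conditional second moment \<open>U\<close> around 1, the conditional
  signed square \<open>H\<close>, and the failure \<open>\<rho>\<close> of \<open>F\<close> to be reproduced by the sum of its deviations. Stein's
  solution, its derivative and \<open>stein_mono z\<close> are each bounded by 2.
\<close>

theorem stein_bound_functional:
  fixes F :: "('i \<Rightarrow> 'a) \<Rightarrow> real"
  defines "U \<equiv> \<lambda>x. (\<Sum>i\<in>I. measure_pmf.expectation (p i) (\<lambda>y. (F x - F (x(i := y)))\<^sup>2)) / 2"
    and "H \<equiv> \<lambda>x. \<Sum>i\<in>I. measure_pmf.expectation (p i) (\<lambda>y. (F x - F (x(i := y))) * \<bar>F x - F (x(i := y))\<bar>)"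
    and "\<rho> \<equiv> \<lambda>x. (\<Sum>i\<in>I. dev i F x) - F x"
  shows "\<bar>expect (\<lambda>x. of_bool (F x \<le> z)) - Phi z\<bar>
    \<le> 2 * (expect (\<lambda>x. \<bar>1 - U x\<bar>) + expect (\<lambda>x. \<bar>H x\<bar>) + expect (\<lambda>x. \<bar>\<rho> x\<bar>))"
proof -
  let ?f = "\<lambda>x. stein z (F x)" and ?g = "\<lambda>x. stein' z (F x)" and ?r = "\<lambda>x. stein_mono z (F x)"
  have abs_bound: "\<bar>expect (\<lambda>x. A x * B x)\<bar> \<le> 2 * expect (\<lambda>x. \<bar>A x\<bar>)" if "\<And>x. \<bar>B x\<bar> \<le> 2" for A B
  proof -
    have "\<bar>expect (\<lambda>x. A x * B x)\<bar> \<le> expect (\<lambda>x. \<bar>A x * B x\<bar>)" by (rule integral_abs_bound)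
    also have "\<dots> \<le> expect (\<lambda>x. \<bar>A x\<bar> * 2)"
      unfolding abs_mult by (intro expect_mono mult_left_mono that) auto
    finally show ?thesis by simp
  qed
  have main: "\<bar>expect (\<lambda>x. (\<Sum>i\<in>I. dev i F x) * ?f x) - expect (\<lambda>x. U x * ?g x)\<bar> \<le> expect (\<lambda>x. H x * ?r x)"
  proof -
    define A where "A i = expect (\<lambda>x. dev i F x * ?f x)
      - expect (\<lambda>x. measure_pmf.expectation (p i) (\<lambda>y. (F x - F (x(i := y)))\<^sup>2) * ?g x) / 2" for i
    define B where "B i = expect (\<lambda>x. measure_pmf.expectation (p i)
        (\<lambda>y. (F x - F (x(i := y))) * \<bar>F x - F (x(i := y))\<bar>) * ?r x)" for i
    have "expect (\<lambda>x. (\<Sum>i\<in>I. dev i F x) * ?f x) - expect (\<lambda>x. U x * ?g x) = sum A I"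
      unfolding U_def A_def by (simp add: sum_distrib_right sum_subtractf sum_divide_distrib)
    moreover have "expect (\<lambda>x. H x * ?r x) = sum B I"
      unfolding H_def B_def by (simp add: sum_distrib_right)
    moreover have "\<bar>sum A I\<bar> \<le> sum B I"
    proof (rule order_trans[OF sum_abs sum_mono])
      show "\<bar>A i\<bar> \<le> B i" if "i \<in> I" for i
        unfolding A_def B_def by (rule stein_exchangeable[OF that])
    qed
    ultimately show ?thesis by simp
  qed
  have "expect (\<lambda>x. of_bool (F x \<le> z)) - Phi z = expect (\<lambda>x. ?g x - F x * ?f x)"
    by (simp add: stein_equation)
  also have "\<dots> = expect (\<lambda>x. (1 - U x) * ?g x + \<rho> x * ?f x + (U x * ?g x - (\<Sum>i\<in>I. dev i F x) * ?f x))"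
    unfolding \<rho>_def by (intro arg_cong[where f = expect] ext) (simp add: algebra_simps)
  also have "\<dots> = expect (\<lambda>x. (1 - U x) * ?g x) + expect (\<lambda>x. \<rho> x * ?f x)
      + (expect (\<lambda>x. U x * ?g x) - expect (\<lambda>x. (\<Sum>i\<in>I. dev i F x) * ?f x))"
    by simp
  finally have "\<bar>expect (\<lambda>x. of_bool (F x \<le> z)) - Phi z\<bar> \<le> \<bar>expect (\<lambda>x. (1 - U x) * ?g x)\<bar> + \<bar>expect (\<lambda>x. \<rho> x * ?f x)\<bar>
      + \<bar>expect (\<lambda>x. H x * ?r x)\<bar>"
    using main by linarith
  also have "\<dots> \<le> 2 * expect (\<lambda>x. \<bar>1 - U x\<bar>) + 2 * expect (\<lambda>x. \<bar>\<rho> x\<bar>) + 2 * expect (\<lambda>x. \<bar>H x\<bar>)"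
    by (intro add_mono abs_bound stein'_bound stein_bound stein_mono_bound)
  finally show ?thesis by simp
qed

text \<open>
  This applies to \<open>w s = s\<^sup>2\<close> and \<open>w s = s * \<bar>s\<bar>\<close>, which have the same modulus of continuity. Changing letter \<open>j\<close>
  affects the summand of \<open>j\<close> by the size of the squared first difference; every other summand only
  feels the second difference, multiplied by a first difference.
\<close>

lemma sum_influence_bound:
  fixes w :: "real \<Rightarrow> real" and F G :: "('i \<Rightarrow> 'a) \<Rightarrow> real" and c1 c2 :: real
  assumes w: "\<And>s t. \<bar>w s - w t\<bar> \<le> \<bar>s - t\<bar> * (\<bar>s\<bar> + \<bar>t\<bar>)" and w0: "w 0 = 0"
    and c1: "\<And>i x y. i \<in> I \<Longrightarrow> \<bar>F x - F (x(i := y))\<bar> \<le> c1"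
    and c2: "\<And>i j x y v. \<lbrakk>i \<in> I; j \<in> I; i \<noteq> j\<rbrakk> \<Longrightarrow>
      \<bar>F x - F (x(i := y)) - F (x(j := v)) + F (x(i := y, j := v))\<bar> \<le> c2"
    and c2_nonneg: "0 \<le> c2" and j: "j \<in> I"
  defines "G \<equiv> \<lambda>x. (\<Sum>i\<in>I. measure_pmf.expectation (p i) (\<lambda>y. w (F x - F (x(i := y)))) :: real)"
  shows "\<bar>G x - G (x(j := v))\<bar> \<le> 2 * c1 * (c1 + card I * c2)"
proof -
  let ?g = "\<lambda>i x. measure_pmf.expectation (p i) (\<lambda>y. w (F x - F (x(i := y))))"
  have c1_nonneg: "0 \<le> c1" using c1[OF j, of x v] by linarith
  have wb: "\<bar>w s\<bar> \<le> c1\<^sup>2" if "\<bar>s\<bar> \<le> c1" for s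
  proof -
    have "\<bar>w s\<bar> \<le> s\<^sup>2" using w[of s 0] by (simp add: w0 power2_eq_square)
    also have "\<dots> \<le> c1\<^sup>2" using power_mono[OF that, of 2] by simp
    finally show ?thesis .
  qed
  have same: "\<bar>?g j x - ?g j (x(j := v))\<bar> \<le> 2 * c1\<^sup>2"
  proof -
    have "\<bar>?g j x\<bar> \<le> c1\<^sup>2" "\<bar>?g j (x(j := v))\<bar> \<le> c1\<^sup>2"
      by (intro expectation_bound wb c1 j)+
    thus ?thesis by linarith
  qed
  have other: "\<bar>?g i x - ?g i (x(j := v))\<bar> \<le> 2 * c1 * c2" if i: "i \<in> I - {j}" for i
  proof -
    have "?g i x - ?g i (x(j := v)) = measure_pmf.expectation (p i)
        (\<lambda>y. w (F x - F (x(i := y))) - w (F (x(j := v)) - F (x(j := v, i := y))))"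
      by simp
    also have "\<bar>\<dots>\<bar> \<le> c2 * (c1 + c1)"
    proof (rule expectation_bound)
      fix y
      let ?s = "F x - F (x(i := y))" and ?t = "F (x(j := v)) - F (x(j := v, i := y))"
      have tw: "x(j := v, i := y) = x(i := y, j := v)" using i by (auto intro: fun_upd_twist)
      have "\<bar>w ?s - w ?t\<bar> \<le> \<bar>?s - ?t\<bar> * (\<bar>?s\<bar> + \<bar>?t\<bar>)" by (rule w)
      also have "\<dots> \<le> c2 * (c1 + c1)"
        using c2[of i j x y v] i j c1[of i] unfolding tw
        by (intro mult_mono add_mono) (auto simp: algebra_simps tw[symmetric])
      finally show "\<bar>w ?s - w ?t\<bar> \<le> c2 * (c1 + c1)" .
    qed
    finally show ?thesis by (simp add: mult_ac)
  qed
  have "\<bar>G x - G (x(j := v))\<bar> = \<bar>\<Sum>i\<in>I. ?g i x - ?g i (x(j := v))\<bar>"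
    unfolding G_def by (simp add: sum_subtractf)
  also have "\<dots> \<le> (\<Sum>i\<in>I. \<bar>?g i x - ?g i (x(j := v))\<bar>)" by (rule sum_abs)
  also have "\<dots> = \<bar>?g j x - ?g j (x(j := v))\<bar> + (\<Sum>i\<in>I - {j}. \<bar>?g i x - ?g i (x(j := v))\<bar>)"
    using finite_I j by (rule sum.remove)
  also have "\<dots> \<le> 2 * c1\<^sup>2 + (\<Sum>i\<in>I - {j}. 2 * c1 * c2)"
    by (intro add_mono same sum_mono other)
  also have "\<dots> \<le> 2 * c1\<^sup>2 + card I * (2 * c1 * c2)"
    using c1_nonneg c2_nonneg finite_I by (auto intro!: mult_right_mono card_mono)
  finally show ?thesis by (simp add: power2_eq_square algebra_simps)
qed

text \<open>
  For \<open>c1\<close> of order \<open>1 / sqrt n\<close> and \<open>c2\<close> of order \<open>1 / sqrt n ^ 3\<close> the bound has order \<open>1 / sqrt n\<close>.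
  The mean of \<open>U\<close> is the sum of the squared deviations, which exceeds the
  variance 1 by at most the sum of the squared mixed deviations; the mean of \<open>H\<close> vanishes by antisymmetry.
\<close>

theorem second_order_berry_esseen:
  assumes mean: "expect F = 0" and var: "expect (\<lambda>x. (F x)\<^sup>2) = 1"
    and c1: "\<And>i x y. i \<in> I \<Longrightarrow> \<bar>F x - F (x(i := y))\<bar> \<le> c1"
    and c2: "\<And>i j x y v. \<lbrakk>i \<in> I; j \<in> I; i \<noteq> j\<rbrakk> \<Longrightarrow>
      \<bar>F x - F (x(i := y)) - F (x(j := v)) + F (x(i := y, j := v))\<bar> \<le> c2"
    and nonneg: "0 \<le> c1" "0 \<le> c2"
  defines "n \<equiv> real (card I)"
  shows "\<bar>expect (\<lambda>x. of_bool (F x \<le> z)) - Phi z\<bar> \<le>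
    2 * ((n * c2)\<^sup>2 + n * c2 + 3 * sqrt n * (c1 * (c1 + n * c2)))"
proof -
  define U where "U = (\<lambda>x. (\<Sum>i\<in>I. measure_pmf.expectation (p i) (\<lambda>y. (F x - F (x(i := y)))\<^sup>2)) / 2)"
  define H where "H = (\<lambda>x. \<Sum>i\<in>I. measure_pmf.expectation (p i) (\<lambda>y. (F x - F (x(i := y))) * \<bar>F x - F (x(i := y))\<bar>))"
  define \<rho> where "\<rho> = (\<lambda>x. (\<Sum>i\<in>I. dev i F x) - F x)"
  define S where "S = (\<Sum>i\<in>I. expect (\<lambda>x. (dev i F x)\<^sup>2))"
  define Q where "Q = (\<Sum>i\<in>I. \<Sum>j\<in>I - {i}. expect (\<lambda>x. (dev i (dev j F) x)\<^sup>2))"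
  have n0: "0 \<le> n" by (simp add: n_def)
  have Q: "Q \<le> (n * c2)\<^sup>2"
  proof -
    have "Q \<le> (\<Sum>i\<in>I. \<Sum>j\<in>I - {i}. c2\<^sup>2)"
      unfolding Q_def by (intro sum_mono expect_sq_bound dev_dev_bound c2) auto
    also have "\<dots> \<le> (\<Sum>i\<in>I. \<Sum>j\<in>I. c2\<^sup>2)"
      using finite_I by (intro sum_mono sum_mono2) auto
    finally show ?thesis by (simp add: n_def power2_eq_square mult_ac)
  qed
  have S1: "1 \<le> S" using Efron_Stein[of F] mean var by (simp add: S_def)
  have rho_sq: "expect (\<lambda>x. (\<rho> x)\<^sup>2) = 1 - S + Q"
    unfolding \<rho>_def S_def Q_def expect_sum_dev_minus_sq var ..
  have S2: "S \<le> 1 + Q"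
  proof -
    have "0 \<le> expect (\<lambda>x. (\<rho> x)\<^sup>2)" by (intro integral_nonneg_AE) auto
    thus ?thesis by (simp add: rho_sq)
  qed
  have rho: "expect (\<lambda>x. \<bar>\<rho> x\<bar>) \<le> n * c2"
  proof -
    have "expect (\<lambda>x. \<bar>\<rho> x\<bar>) \<le> sqrt (expect (\<lambda>x. (\<rho> x)\<^sup>2))" by (rule expect_abs_le_sqrt)
    also have "\<dots> \<le> sqrt ((n * c2)\<^sup>2)"
      using S1 Q unfolding rho_sq by (intro real_sqrt_le_mono) linarith
    finally show ?thesis using n0 nonneg by simp
  qed
  define K where "K = c1 * (c1 + n * c2)"
  have K0: "0 \<le> K" unfolding K_def using n0 nonneg by simp
  have EU: "expect U = S"
    unfolding U_def S_def by (simp add: sum_divide_distrib expect_dev_sq del: divide_eq_eq_numeral1)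
  have U_dev: "expect (\<lambda>x. \<bar>U x - expect U\<bar>) \<le> sqrt n * K"
    unfolding n_def
  proof (rule expect_abs_deviation_bound[OF _ K0])
    fix j x v assume j: "j \<in> I"
    show "\<bar>U x - U (x(j := v))\<bar> \<le> K"
      using sum_influence_bound[where F = F and ?c1.0 = c1 and ?c2.0 = c2 and w = "\<lambda>s. s\<^sup>2", OF square_diff _ c1 c2 nonneg(2) j, of x v]
      unfolding U_def K_def n_def by (simp add: diff_divide_distrib[symmetric] abs_divide mult_ac)
  qed
  have H_dev: "expect (\<lambda>x. \<bar>H x - expect H\<bar>) \<le> sqrt n * (2 * K)"
    unfolding n_def
  proof (rule expect_abs_deviation_bound)
    show "0 \<le> 2 * K" using K0 by simp
    fix j x v assume j: "j \<in> I"
    show "\<bar>H x - H (x(j := v))\<bar> \<le> 2 * K"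
      using sum_influence_bound[where F = F and ?c1.0 = c1 and ?c2.0 = c2 and w = "\<lambda>s. s * \<bar>s\<bar>", OF signed_square_diff _ c1 c2 nonneg(2) j, of x v]
      unfolding H_def K_def n_def by (simp add: mult_ac)
  qed
  have EH: "expect H = 0"
    unfolding H_def using expect_pair_antisym[of _ "\<lambda>x x'. (F x - F x') * \<bar>F x - F x'\<bar>"]
    by (simp add: abs_minus_commute algebra_simps)
  have "expect (\<lambda>x. \<bar>1 - U x\<bar>) \<le> expect (\<lambda>x. \<bar>U x - expect U\<bar> + (n * c2)\<^sup>2)"
  proof (rule expect_mono)
    show "\<bar>1 - U x\<bar> \<le> \<bar>U x - expect U\<bar> + (n * c2)\<^sup>2" for x
      using S1 S2 Q unfolding EU by linarith
  qed
  hence "expect (\<lambda>x. \<bar>1 - U x\<bar>) \<le> sqrt n * K + (n * c2)\<^sup>2"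
    using U_dev by simp
  moreover have "expect (\<lambda>x. \<bar>H x\<bar>) \<le> sqrt n * (2 * K)"
    using H_dev by (simp add: EH)
  ultimately have "expect (\<lambda>x. \<bar>1 - U x\<bar>) + expect (\<lambda>x. \<bar>H x\<bar>) + expect (\<lambda>x. \<bar>\<rho> x\<bar>)
      \<le> (sqrt n * K + (n * c2)\<^sup>2) + sqrt n * (2 * K) + n * c2"
    by (intro add_mono rho)
  also have "\<dots> = (n * c2)\<^sup>2 + n * c2 + 3 * sqrt n * (c1 * (c1 + n * c2))"
    unfolding K_def[symmetric] by simp
  finally have "2 * (expect (\<lambda>x. \<bar>1 - U x\<bar>) + expect (\<lambda>x. \<bar>H x\<bar>) + expect (\<lambda>x. \<bar>\<rho> x\<bar>)) \<le>
      2 * ((n * c2)\<^sup>2 + n * c2 + 3 * sqrt n * (c1 * (c1 + n * c2)))"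
    by simp
  thus ?thesis
    unfolding U_def H_def \<rho>_def by (rule order_trans[OF stein_bound_functional])
qed

end

section \<open>Weights of overlapping pairs of subsequences\<close>

lemma finite_weak_comps: "finite J \<Longrightarrow> finite (weak_comps J l)"
proof (rule finite_subset)
  assume J: "finite J"
  show "weak_comps J l \<subseteq> J \<rightarrow>\<^sub>E {..l}"
    using J by (auto simp: weak_comps_def PiE_iff extensional_def intro: member_le_sum)
  show "finite (J \<rightarrow>\<^sub>E {..l})" using J by (intro finite_PiE) auto
qed

lemma sum_weak_comps_insert:
  assumes J: "finite J" "m \<notin> J"
  shows "sum f (weak_comps (insert m J) l) = (\<Sum>s\<le>l. \<Sum>x\<in>weak_comps J (l - s). f (x(m := s)))"
proof -
  have "(\<Sum>s\<le>l. \<Sum>x\<in>weak_comps J (l - s). f (x(m := s)))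
      = (\<Sum>(s, x)\<in>Sigma {..l} (\<lambda>s. weak_comps J (l - s)). f (x(m := s)))"
    using J by (subst sum.Sigma) (auto simp: finite_weak_comps)
  also have "\<dots> = sum f (weak_comps (insert m J) l)"
  proof (rule sum.reindex_bij_witness[of _ "\<lambda>x. (x m, x(m := undefined))" "\<lambda>(s, x). x(m := s)"], goal_cases)
    case (1 q)
    then obtain s x where q: "q = (s, x)" and x: "x \<in> weak_comps J (l - s)" by auto
    have "x m = undefined" using x J by (auto simp: weak_comps_def PiE_iff extensional_def)
    thus ?case using q by auto
  next
    case (2 q)
    then obtain s x where q: "q = (s, x)" "s \<le> l" and x: "x \<in> weak_comps J (l - s)" by auto
    have "(\<Sum>j\<in>J. (x(m := s)) j) = (\<Sum>j\<in>J. x j)" using J by (intro sum.cong) auto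
    thus ?case using q x J by (auto simp: weak_comps_def PiE_iff extensional_def)
  next
    case (3 x)
    thus ?case by auto
  next
    case (4 x)
    have "(\<Sum>j\<in>J. (x(m := undefined)) j) = (\<Sum>j\<in>J. x j)" using J by (intro sum.cong) auto
    thus ?case using 4 J by (auto simp: weak_comps_def PiE_iff extensional_def)
  qed auto
  finally show ?thesis by simp
qed

lemma weak_comps_empty: "weak_comps {} l = (if l = 0 then {\<lambda>_. undefined} else {})"
  by (auto simp: weak_comps_def)

text \<open>
  The complete homogeneous symmetric polynomial of degree \<open>u\<close> in \<open>w lo, \<dots>, w hi\<close>. For letter
  probabilities \<open>w\<close> it is the probability that \<open>u\<close> independent letters are weakly increasing and lie in
  \<open>{lo..hi}\<close>.
\<close>

definition complete_hom :: "(nat \<Rightarrow> real) \<Rightarrow> nat \<Rightarrow> nat \<Rightarrow> nat \<Rightarrow> real" where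
  "complete_hom w lo hi u = (\<Sum>x\<in>weak_comps {lo..hi} u. \<Prod>j=lo..hi. w j ^ x j)"

lemma complete_hom_empty: "hi < lo \<Longrightarrow> complete_hom w lo hi u = (if u = 0 then 1 else 0)"
  by (simp add: complete_hom_def weak_comps_empty)

lemma complete_hom_Suc_hi:
  assumes "lo \<le> Suc hi"
  shows "complete_hom w lo (Suc hi) u = (\<Sum>s\<le>u. w (Suc hi) ^ s * complete_hom w lo hi (u - s))"
proof -
  have "{lo..Suc hi} = insert (Suc hi) {lo..hi}" using assms by auto
  hence "complete_hom w lo (Suc hi) u =
      (\<Sum>s\<le>u. \<Sum>x\<in>weak_comps {lo..hi} (u - s). \<Prod>j\<in>insert (Suc hi) {lo..hi}. w j ^ (x(Suc hi := s)) j)"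
    unfolding complete_hom_def by (simp add: sum_weak_comps_insert)
  also have "\<dots> = (\<Sum>s\<le>u. \<Sum>x\<in>weak_comps {lo..hi} (u - s). w (Suc hi) ^ s * (\<Prod>j\<in>{lo..hi}. w j ^ x j))"
    by (intro sum.cong refl, subst prod.insert) (auto intro!: prod.cong)
  finally show ?thesis by (simp add: complete_hom_def sum_distrib_left)
qed

lemma complete_hom_0: "complete_hom w lo hi 0 = 1"
proof (induction hi)
  case 0
  show ?case
  proof (cases "lo = 0")
    case True
    have "{0..0::nat} = insert 0 {}" by auto
    thus ?thesis using True unfolding complete_hom_def by (simp add: sum_weak_comps_insert weak_comps_empty)
  qed (simp add: complete_hom_empty)
next
  case (Suc hi)
  thus ?case by (cases "lo \<le> Suc hi") (simp_all add: complete_hom_Suc_hi complete_hom_empty)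
qed

lemma complete_hom_Suc_Suc:
  assumes "lo \<le> Suc hi"
  shows "complete_hom w lo (Suc hi) (Suc u) = complete_hom w lo hi (Suc u) + w (Suc hi) * complete_hom w lo (Suc hi) u"
  unfolding complete_hom_Suc_hi[OF assms]
  by (subst sum.atMost_Suc_shift) (simp add: sum_distrib_left mult.assoc)

text \<open>
  The factor \<open>w c\<close> belongs to the largest letter. The bound \<open>1 \<le> lo\<close> makes the interval \<open>{lo..0}\<close>, where the
  induction starts, empty.
\<close>

lemma complete_hom_Suc:
  assumes "1 \<le> lo"
  shows "complete_hom w lo hi (Suc u) = (\<Sum>c=lo..hi. w c * complete_hom w lo c u)"
proof (induction hi)
  case 0
  show ?case using assms by (simp add: complete_hom_empty)
next
  case (Suc hi)
  thus ?case by (cases "lo \<le> Suc hi") (simp_all add: complete_hom_Suc_Suc complete_hom_empty)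
qed

text \<open>
  The weight of all interleavings of \<open>u\<close> positions of a first and \<open>v\<close> positions of a second
  subsequence on disjoint sets of positions, with letters at least \<open>lo\<close> and at most \<open>a\<close> and \<open>b\<close>,
  respectively.
\<close>

definition shuffle_weight :: "(nat \<Rightarrow> real) \<Rightarrow> nat \<Rightarrow> nat \<Rightarrow> nat \<Rightarrow> nat \<Rightarrow> nat \<Rightarrow> real" where
  "shuffle_weight w lo a b u v = real ((u + v) choose u) * complete_hom w lo a u * complete_hom w lo b v"

text \<open>
  The three terms are the empty interleaving, those whose last position belongs to the first subsequence,
  and those whose last position belongs to the second. If both blocks are nonempty this is Pascal's rule.
\<close>

lemma shuffle_weight_step:
  assumes lo: "1 \<le> lo"
  shows "shuffle_weight w lo a b u v = of_bool (u = 0 \<and> v = 0)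
    + (if u = 0 then 0 else \<Sum>c=lo..a. w c * shuffle_weight w lo c b (u - 1) v)
    + (if v = 0 then 0 else \<Sum>c=lo..b. w c * shuffle_weight w lo a c u (v - 1))"
proof -
  have A: "(\<Sum>c=lo..a. w c * shuffle_weight w lo c b u v) = real ((u + v) choose u) * complete_hom w lo a (Suc u) * complete_hom w lo b v" for u v
    by (simp add: complete_hom_Suc[OF lo] shuffle_weight_def sum_distrib_left sum_distrib_right mult_ac)
  have B: "(\<Sum>c=lo..b. w c * shuffle_weight w lo a c u v) = real ((u + v) choose u) * complete_hom w lo a u * complete_hom w lo b (Suc v)" for u v
    by (simp add: complete_hom_Suc[OF lo] shuffle_weight_def sum_distrib_left sum_distrib_right mult_ac)
  show ?thesis
    unfolding A B by (cases u; cases v) (simp_all add: shuffle_weight_def complete_hom_0 algebra_simps)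
qed

text \<open>
  The weight of all pairs of subsequences that cover an interval of positions and share \<open>t\<close> of them, with
  \<open>l\<close> positions used by the first only and \<open>r\<close> by the second only, and with letters at most \<open>a\<close> and \<open>b\<close>.
  The recursion removes the last shared position, whose letter is \<open>c\<close>, together with everything after it.
  Two separate upper bounds are kept because removing a position of only one subsequence lowers only one
  of them.
\<close>

fun pattern_weight :: "(nat \<Rightarrow> real) \<Rightarrow> nat \<Rightarrow> nat \<Rightarrow> nat \<Rightarrow> nat \<Rightarrow> nat \<Rightarrow> real" where
  "pattern_weight w 0 l r a b = shuffle_weight w 1 a b l r"
| "pattern_weight w (Suc t) l r a b =
     (\<Sum>c=1..min a b. w c * (\<Sum>u\<le>l. \<Sum>v\<le>r. shuffle_weight w c a b u v * pattern_weight w t (l - u) (r - v) c c))"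

lemma sum_atMost_pred:
  "(\<Sum>u\<le>l. if u = 0 then 0 else f (u - 1) u) = (if l = 0 then 0 else \<Sum>u\<le>l - 1. f u (Suc u) :: real)"
  by (cases l) (simp_all add: sum.atMost_Suc_shift del: sum.atMost_Suc)

lemma sum_nested_range:
  "(\<Sum>c=1..min a b. \<Sum>d=c..a. f c d) = (\<Sum>d=1..a. \<Sum>c=1..min d b. f c d :: real)" for a b :: nat
proof -
  have "(\<Sum>c=1..min a b. \<Sum>d=c..a. f c d) = (\<Sum>(c, d)\<in>Sigma {1..min a b} (\<lambda>c. {c..a}). f c d)"
    by (subst sum.Sigma) auto
  also have "\<dots> = (\<Sum>(d, c)\<in>Sigma {1..a} (\<lambda>d. {1..min d b}). f c d)"
    by (rule sum.reindex_bij_witness[of _ "\<lambda>(d, c). (c, d)" "\<lambda>(c, d). (d, c)"]) auto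
  also have "\<dots> = (\<Sum>d=1..a. \<Sum>c=1..min d b. f c d)"
    by (subst sum.Sigma) auto
  finally show ?thesis .
qed

lemma sum_extract:
  "(\<Sum>u\<in>U. \<Sum>v\<in>V. (\<Sum>d\<in>D. w d * K d u v) * G u v) = (\<Sum>d\<in>D. w d * (\<Sum>u\<in>U. \<Sum>v\<in>V. K d u v * G u v :: real))"
proof -
  have "(\<Sum>u\<in>U. \<Sum>v\<in>V. (\<Sum>d\<in>D. w d * K d u v) * G u v) = (\<Sum>u\<in>U. \<Sum>v\<in>V. \<Sum>d\<in>D. w d * K d u v * G u v)"
    by (simp add: sum_distrib_right)
  also have "\<dots> = (\<Sum>u\<in>U. \<Sum>d\<in>D. \<Sum>v\<in>V. w d * K d u v * G u v)"
    by (intro sum.cong refl sum.swap)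
  also have "\<dots> = (\<Sum>d\<in>D. \<Sum>u\<in>U. \<Sum>v\<in>V. w d * K d u v * G u v)"
    by (rule sum.swap)
  finally show ?thesis by (simp add: sum_distrib_left mult.assoc)
qed

lemma sum_nested_extract:
  "(\<Sum>c=1..min a b. w c * (\<Sum>u\<in>U. \<Sum>v\<in>V. (\<Sum>d=c..a. w d * K c d u v) * G c u v))
    = (\<Sum>d=1..a. w d * (\<Sum>c=1..min d b. w c * (\<Sum>u\<in>U. \<Sum>v\<in>V. K c d u v * G c u v :: real)))" for a b :: nat
proof -
  have "(\<Sum>c=1..min a b. w c * (\<Sum>u\<in>U. \<Sum>v\<in>V. (\<Sum>d=c..a. w d * K c d u v) * G c u v))
      = (\<Sum>c=1..min a b. \<Sum>d=c..a. w d * (w c * (\<Sum>u\<in>U. \<Sum>v\<in>V. K c d u v * G c u v)))"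
    unfolding sum_extract by (simp add: sum_distrib_left mult_ac)
  also have "\<dots> = (\<Sum>d=1..a. \<Sum>c=1..min d b. w d * (w c * (\<Sum>u\<in>U. \<Sum>v\<in>V. K c d u v * G c u v)))"
    by (rule sum_nested_range)
  finally show ?thesis by (simp add: sum_distrib_left)
qed

text \<open>
  This recursion removes the last position. It is used by the first subsequence only, by the second
  only, or by both. In the presence of shared positions the recursion is inherited from that of the last
  block of unshared ones.
\<close>

lemma pattern_weight_step:
  "pattern_weight w t l r a b = of_bool (t = 0 \<and> l = 0 \<and> r = 0)
    + (if l = 0 then 0 else \<Sum>c=1..a. w c * pattern_weight w t (l - 1) r c b)
    + (if r = 0 then 0 else \<Sum>c=1..b. w c * pattern_weight w t l (r - 1) a c)
    + (if t = 0 then 0 else \<Sum>c=1..min a b. w c * pattern_weight w (t - 1) l r c c)"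
proof (cases t)
  case 0
  thus ?thesis using shuffle_weight_step[of 1 w a b l r] by simp
next
  case (Suc t')
  let ?G = "\<lambda>c u v. pattern_weight w t' (l - u) (r - v) c c"
  let ?A = "\<lambda>c u v. \<Sum>d=c..a. w d * shuffle_weight w c d b u v"
  let ?B = "\<lambda>c u v. \<Sum>d=c..b. w d * shuffle_weight w c a d u v"
  have inner: "(\<Sum>u\<le>l. \<Sum>v\<le>r. shuffle_weight w c a b u v * ?G c u v) = pattern_weight w t' l r c c
      + (if l = 0 then 0 else \<Sum>u\<le>l - 1. \<Sum>v\<le>r. ?A c u v * ?G c (Suc u) v)
      + (if r = 0 then 0 else \<Sum>u\<le>l. \<Sum>v\<le>r - 1. ?B c u v * ?G c u (Suc v))" if c: "1 \<le> c" for c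
  proof -
    have "shuffle_weight w c a b u v * ?G c u v = of_bool (u = 0) * (of_bool (v = 0) * ?G c u v)
        + (if u = 0 then 0 else ?A c (u - 1) v * ?G c u v)
        + (if v = 0 then 0 else ?B c u (v - 1) * ?G c u v)" for u v
      by (subst shuffle_weight_step[OF c]) (auto simp: distrib_right)
    hence "(\<Sum>u\<le>l. \<Sum>v\<le>r. shuffle_weight w c a b u v * ?G c u v)
       = (\<Sum>u\<le>l. \<Sum>v\<le>r. of_bool (u = 0) * (of_bool (v = 0) * ?G c u v))
       + (\<Sum>u\<le>l. if u = 0 then 0 else \<Sum>v\<le>r. ?A c (u - 1) v * ?G c u v)
       + (\<Sum>u\<le>l. \<Sum>v\<le>r. if v = 0 then 0 else ?B c u (v - 1) * ?G c u v)"
      by (simp add: sum.distrib) (auto intro!: sum.cong)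
    also have "(\<Sum>u\<le>l. \<Sum>v\<le>r. of_bool (u = 0) * (of_bool (v = 0) * ?G c u v)) = pattern_weight w t' l r c c"
    proof -
      have "(\<Sum>u\<le>l. \<Sum>v\<le>r. of_bool (u = 0) * (of_bool (v = 0) * ?G c u v))
         = (\<Sum>u\<in>{0}. \<Sum>v\<le>r. of_bool (v = 0) * ?G c u v)"
        by (intro sum.mono_neutral_cong_right) auto
      also have "\<dots> = (\<Sum>v\<in>{0}. ?G c 0 v)"
        by simp
      finally show ?thesis by simp
    qed
    also have "(\<Sum>u\<le>l. if u = 0 then 0 else \<Sum>v\<le>r. ?A c (u - 1) v * ?G c u v)
        = (if l = 0 then 0 else \<Sum>u\<le>l - 1. \<Sum>v\<le>r. ?A c u v * ?G c (Suc u) v)"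
      by (rule sum_atMost_pred)
    also have "(\<Sum>u\<le>l. \<Sum>v\<le>r. if v = 0 then 0 else ?B c u (v - 1) * ?G c u v)
        = (if r = 0 then 0 else \<Sum>u\<le>l. \<Sum>v\<le>r - 1. ?B c u v * ?G c u (Suc v))"
      by (subst sum_atMost_pred) simp
    finally show ?thesis .
  qed
  have *: "pattern_weight w t l r a b = (\<Sum>c=1..min a b. w c * pattern_weight w t' l r c c)
      + (if l = 0 then 0 else \<Sum>c=1..min a b. w c * (\<Sum>u\<le>l - 1. \<Sum>v\<le>r. ?A c u v * ?G c (Suc u) v))
      + (if r = 0 then 0 else \<Sum>c=1..min a b. w c * (\<Sum>u\<le>l. \<Sum>v\<le>r - 1. ?B c u v * ?G c u (Suc v)))"
    using Suc by (simp add: inner distrib_left sum.distrib)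
  have A: "(\<Sum>c=1..min a b. w c * (\<Sum>u\<le>l - 1. \<Sum>v\<le>r. ?A c u v * ?G c (Suc u) v))
      = (\<Sum>d=1..a. w d * pattern_weight w t (l - 1) r d b)"
    unfolding sum_nested_extract Suc by simp
  have B: "(\<Sum>c=1..min a b. w c * (\<Sum>u\<le>l. \<Sum>v\<le>r - 1. ?B c u v * ?G c u (Suc v)))
      = (\<Sum>d=1..b. w d * pattern_weight w t l (r - 1) a d)"
    unfolding min.commute[of a b] sum_nested_extract Suc by (simp add: min.commute)
  show ?thesis unfolding * A B using Suc by simp
qed

text \<open>
  The \<open>k + k' - t\<close> positions of a pair with \<open>t\<close> common ones can be chosen freely among \<open>n\<close>, because the
  letters are identically distributed.
\<close>

definition pair_moment :: "(nat \<Rightarrow> real) \<Rightarrow> nat \<Rightarrow> nat \<Rightarrow> nat \<Rightarrow> nat \<Rightarrow> nat \<Rightarrow> real" where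
  "pair_moment w n k k' a b = (\<Sum>t\<le>min k k'. real (n choose (k + k' - t)) * pattern_weight w t (k - t) (k' - t) a b)"

text \<open>
  Pascal's rule separates the patterns that do not use position \<open>Suc n\<close>; the others are classified by
  \<open>pattern_weight_step\<close>.
\<close>

lemma pair_moment_Suc:
  "pair_moment w (Suc n) (Suc k) (Suc k') a b = pair_moment w n (Suc k) (Suc k') a b
    + (\<Sum>c=1..a. w c * pair_moment w n k (Suc k') c b)
    + (\<Sum>c=1..b. w c * pair_moment w n (Suc k) k' a c)
    + (\<Sum>c=1..min a b. w c * pair_moment w n k k' c c)"
proof -
  let ?m = "min (Suc k) (Suc k')"
  let ?C = "\<lambda>t. real (n choose (Suc (k + k') - t))"
  have pascal: "real (Suc n choose (Suc k + Suc k' - t)) = real (n choose (Suc k + Suc k' - t)) + ?C t"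
    if "t \<le> ?m" for t
  proof -
    have "Suc k + Suc k' - t = Suc (Suc (k + k') - t)" using that by simp
    thus ?thesis by simp
  qed
  have step: "pattern_weight w t (Suc k - t) (Suc k' - t) a b =
      (if t \<le> k then \<Sum>c=1..a. w c * pattern_weight w t (k - t) (Suc k' - t) c b else 0)
    + (if t \<le> k' then \<Sum>c=1..b. w c * pattern_weight w t (Suc k - t) (k' - t) a c else 0)
    + (if t = 0 then 0 else \<Sum>c=1..min a b. w c * pattern_weight w (t - 1) (Suc k - t) (Suc k' - t) c c)"
    if "t \<le> ?m" for t
    using that by (subst pattern_weight_step) (auto simp: Suc_diff_le)
  have "pair_moment w (Suc n) (Suc k) (Suc k') a b = pair_moment w n (Suc k) (Suc k') a b
     + (\<Sum>t\<le>?m. ?C t * pattern_weight w t (Suc k - t) (Suc k' - t) a b)"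
    unfolding pair_moment_def sum.distrib[symmetric]
    by (intro sum.cong refl) (subst pascal, auto simp: distrib_right)
  also have "(\<Sum>t\<le>?m. ?C t * pattern_weight w t (Suc k - t) (Suc k' - t) a b) =
      (\<Sum>t\<le>?m. if t \<le> k then ?C t * (\<Sum>c=1..a. w c * pattern_weight w t (k - t) (Suc k' - t) c b) else 0)
    + (\<Sum>t\<le>?m. if t \<le> k' then ?C t * (\<Sum>c=1..b. w c * pattern_weight w t (Suc k - t) (k' - t) a c) else 0)
    + (\<Sum>t\<le>?m. if t = 0 then 0 else ?C t * (\<Sum>c=1..min a b. w c * pattern_weight w (t - 1) (Suc k - t) (Suc k' - t) c c))"
    unfolding sum.distrib[symmetric]
    by (rule sum.cong[OF refl]) (subst step, auto simp: distrib_left)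
  also have "(\<Sum>t\<le>?m. if t \<le> k then ?C t * (\<Sum>c=1..a. w c * pattern_weight w t (k - t) (Suc k' - t) c b) else 0)
      = (\<Sum>t\<le>min k (Suc k'). ?C t * (\<Sum>c=1..a. w c * pattern_weight w t (k - t) (Suc k' - t) c b))"
    by (intro sum.mono_neutral_cong_right) auto
  also have "\<dots> = (\<Sum>c=1..a. w c * pair_moment w n k (Suc k') c b)"
    unfolding pair_moment_def sum_distrib_left by (subst sum.swap) (simp add: mult_ac)
  also have "(\<Sum>t\<le>?m. if t \<le> k' then ?C t * (\<Sum>c=1..b. w c * pattern_weight w t (Suc k - t) (k' - t) a c) else 0)
      = (\<Sum>t\<le>min (Suc k) k'. ?C t * (\<Sum>c=1..b. w c * pattern_weight w t (Suc k - t) (k' - t) a c))"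
    by (intro sum.mono_neutral_cong_right) auto
  also have "\<dots> = (\<Sum>c=1..b. w c * pair_moment w n (Suc k) k' a c)"
    unfolding pair_moment_def sum_distrib_left by (subst sum.swap) (simp add: mult_ac)
  also have "(\<Sum>t\<le>?m. if t = 0 then 0 else ?C t * (\<Sum>c=1..min a b. w c * pattern_weight w (t - 1) (Suc k - t) (Suc k' - t) c c))
      = (\<Sum>t\<le>min k k'. ?C (Suc t) * (\<Sum>c=1..min a b. w c * pattern_weight w t (k - t) (k' - t) c c))"
    by (simp add: min_Suc_Suc sum.atMost_Suc_shift del: sum.atMost_Suc)
  also have "\<dots> = (\<Sum>c=1..min a b. w c * pair_moment w n k k' c c)"
    unfolding pair_moment_def sum_distrib_left by (subst sum.swap) (simp add: mult_ac)
  finally show ?thesis by (simp only: add.assoc)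
qed

lemma shared_values_step: "\<alpha> \<in> shared_values a t \<Longrightarrow> i < t + 1 \<Longrightarrow> \<alpha> i \<le> \<alpha> (Suc i)"
proof -
  assume "\<alpha> \<in> shared_values a t" "i < t + 1"
  hence "\<forall>j\<in>{1..t + 1}. \<alpha> (j - 1) \<le> \<alpha> j" "Suc i \<in> {1..t + 1}" by (auto simp: shared_values_def)
  from bspec[OF this] show "\<alpha> i \<le> \<alpha> (Suc i)" by simp
qed

lemma shared_values_ge_1: "\<alpha> \<in> shared_values a t \<Longrightarrow> i \<le> t + 1 \<Longrightarrow> 1 \<le> \<alpha> i"
proof (induction i)
  case (Suc i)
  thus ?case using shared_values_step[of \<alpha> a t i] by simp
qed (simp add: shared_values_def)

lemma finite_shared_values: "finite (shared_values a t)"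
proof (rule finite_subset)
  have mono: "\<alpha> i \<le> \<alpha> (t + 1)" if "\<alpha> \<in> shared_values a t" "i \<le> t + 1" for \<alpha> i
    using that(2)
  proof (induction i rule: inc_induct)
    case (step i)
    thus ?case using shared_values_step[OF that(1), of i] by simp
  qed simp
  show "shared_values a t \<subseteq> {0..t + 1} \<rightarrow>\<^sub>E {..a}"
  proof
    fix \<alpha> assume \<alpha>: "\<alpha> \<in> shared_values a t"
    hence "\<alpha> (t + 1) = a" by (simp add: shared_values_def)
    thus "\<alpha> \<in> {0..t + 1} \<rightarrow>\<^sub>E {..a}"
      using mono[OF \<alpha>] \<alpha> by (auto simp: shared_values_def PiE_iff)
  qed
qed (auto intro: finite_PiE)

text \<open>
  The new sentinel \<open>a\<close> is put after the old one, \<open>c\<close>, which becomes the last genuine shared value.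
\<close>

lemma sum_shared_values_Suc:
  "sum f (shared_values a (Suc t)) = (\<Sum>c=1..a. \<Sum>\<alpha>\<in>shared_values c t. f (\<alpha>(t + 2 := a)))"
proof -
  have "(\<Sum>c=1..a. \<Sum>\<alpha>\<in>shared_values c t. f (\<alpha>(t + 2 := a)))
      = (\<Sum>(c, \<alpha>)\<in>Sigma {1..a} (\<lambda>c. shared_values c t). f (\<alpha>(t + 2 := a)))"
    by (subst sum.Sigma) (auto simp: finite_shared_values)
  also have "\<dots> = sum f (shared_values a (Suc t))"
  proof (rule sum.reindex_bij_witness[of _ "\<lambda>\<alpha>. (\<alpha> (t + 1), \<alpha>(t + 2 := undefined))" "\<lambda>(c, \<alpha>). \<alpha>(t + 2 := a)"], goal_cases)
    case (1 q)
    then obtain c \<alpha> where q: "q = (c, \<alpha>)" and \<alpha>: "\<alpha> \<in> shared_values c t" by auto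
    have "\<alpha> (t + 2) = undefined" "\<alpha> (t + 1) = c"
      using \<alpha> by (auto simp: shared_values_def PiE_iff extensional_def)
    thus ?case using q by auto
  next
    case (2 q)
    then obtain c \<alpha> where q: "q = (c, \<alpha>)" "c \<le> a" and \<alpha>: "\<alpha> \<in> shared_values c t" by auto
    have "(\<alpha>(t + 2 := a)) (i - 1) \<le> (\<alpha>(t + 2 := a)) i" if "i \<in> {1..Suc t + 1}" for i
      using that \<alpha> q by (cases "i = t + 2") (auto simp: shared_values_def)
    thus ?case using q \<alpha> by (auto simp: shared_values_def PiE_iff extensional_def)
  next
    case (3 \<alpha>)
    thus ?case by (auto simp: shared_values_def)
  next
    case (4 \<alpha>)
    have mono: "\<alpha> (i - 1) \<le> \<alpha> i" if "i \<in> {1..Suc t + 1}" for i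
      using that 4 by (auto simp: shared_values_def)
    have "\<alpha> (t + 1) \<le> a" using mono[of "t + 2"] 4 by (simp add: shared_values_def)
    moreover have "1 \<le> \<alpha> (t + 1)" using shared_values_ge_1[OF 4, of "t + 1"] by simp
    moreover have "(\<alpha>(t + 2 := undefined)) (i - 1) \<le> (\<alpha>(t + 2 := undefined)) i" if "i \<in> {1..t + 1}" for i
      using that mono[of i] by auto
    ultimately show ?case using 4 by (auto simp: shared_values_def PiE_iff extensional_def)
  qed auto
  finally show ?thesis by simp
qed

text \<open>
  The summand of the second moment for \<open>t\<close> shared positions, with the two inner sums over letter counts
  factored. Unlike \<open>pattern_weight\<close> it is a sum over whole sequences of shared values.
\<close>

definition shared_value_sum :: "(nat \<Rightarrow> real) \<Rightarrow> nat \<Rightarrow> nat \<Rightarrow> nat \<Rightarrow> nat \<Rightarrow> real" where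
  "shared_value_sum w a t l r = (\<Sum>\<alpha> \<in> shared_values a t. \<Sum>u \<in> weak_comps {1..t + 1} l. \<Sum>v \<in> weak_comps {1..t + 1} r.
     (\<Prod>i = 1..t. w (\<alpha> i)) * (\<Prod>i = 1..t + 1. shuffle_weight w (\<alpha> (i - 1)) (\<alpha> i) (\<alpha> i) (u i) (v i)))"

lemma shared_value_sum_0:
  assumes "1 \<le> a" shows "shared_value_sum w a 0 l r = shuffle_weight w 1 a a l r"
proof -
  let ?\<alpha> = "\<lambda>i. if i = 0 then 1 else if i = 1 then a else undefined :: nat"
  have sv: "shared_values a 0 = {?\<alpha>}"
    using assms by (auto simp: shared_values_def PiE_iff extensional_def fun_eq_iff)
  have wc: "sum f (weak_comps {Suc 0} l) = f ((\<lambda>_. undefined)(1 := l))" for f :: "_ \<Rightarrow> real" and l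
  proof -
    have "sum f (weak_comps (insert 1 {}) l)
        = (\<Sum>s\<le>l. \<Sum>x\<in>weak_comps {} (l - s). f (x(1 := s)))"
      by (subst sum_weak_comps_insert) auto
    also have "\<dots> = (\<Sum>s\<le>l. if s = l then f ((\<lambda>_. undefined)(1 := l)) else 0)"
      by (intro sum.cong) (auto simp: weak_comps_empty fun_upd_def)
    finally show ?thesis by simp
  qed
  show ?thesis unfolding shared_value_sum_def sv by (simp add: wc)
qed

text \<open>
  Removing the last block from the sum over sequences gives the defining recursion of \<open>pattern_weight\<close>.
\<close>

lemma shared_value_sum_Suc:
  "shared_value_sum w a (Suc t) l r = (\<Sum>c=1..a. w c * (\<Sum>u\<le>l. \<Sum>v\<le>r. shuffle_weight w c a a u v * shared_value_sum w c t (l - u) (r - v)))"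
proof -
  let ?f = "\<lambda>t \<alpha> u v. (\<Prod>i = 1..t. w (\<alpha> i)) * (\<Prod>i = 1..t + 1. shuffle_weight w (\<alpha> (i - 1)) (\<alpha> i) (\<alpha> i) (u i) (v i))"
  have ins: "{1..Suc t + 1} = insert (t + 2) {1..t + 1}" by auto
  have wc: "sum f (weak_comps {1..Suc t + 1} l) = (\<Sum>s\<le>l. \<Sum>x\<in>weak_comps {1..t + 1} (l - s). f (x(t + 2 := s)))"
    for f :: "_ \<Rightarrow> real" and l unfolding ins by (subst sum_weak_comps_insert) auto
  have f: "?f (Suc t) (\<alpha>(t + 2 := a)) (u(t + 2 := s)) (v(t + 2 := s')) = w c * (shuffle_weight w c a a s s' * ?f t \<alpha> u v)"
    if "\<alpha> \<in> shared_values c t" for \<alpha> u v s s' c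
  proof -
    have c: "\<alpha> (t + 1) = c" using that by (simp add: shared_values_def)
    have "(\<Prod>i = 1..Suc t. w ((\<alpha>(t + 2 := a)) i)) = (\<Prod>i = 1..Suc t. w (\<alpha> i))"
      by (intro prod.cong) auto
    also have "\<dots> = w c * (\<Prod>i = 1..t. w (\<alpha> i))" using c by simp
    finally have 1: "(\<Prod>i = 1..Suc t. w ((\<alpha>(t + 2 := a)) i)) = w c * (\<Prod>i = 1..t. w (\<alpha> i))" .
    have 2: "(\<Prod>i = 1..Suc t + 1. shuffle_weight w ((\<alpha>(t + 2 := a)) (i - 1)) ((\<alpha>(t + 2 := a)) i) ((\<alpha>(t + 2 := a)) i)
        ((u(t + 2 := s)) i) ((v(t + 2 := s')) i))
      = shuffle_weight w c a a s s' * (\<Prod>i = 1..t + 1. shuffle_weight w (\<alpha> (i - 1)) (\<alpha> i) (\<alpha> i) (u i) (v i))"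
      unfolding ins using c by (subst prod.insert) (auto intro!: arg_cong2[where f = "(*)"] prod.cong)
    show ?thesis unfolding 1 2 by (simp add: mult_ac)
  qed
  have "shared_value_sum w a (Suc t) l r = (\<Sum>c=1..a. \<Sum>\<alpha>\<in>shared_values c t.
      \<Sum>s\<le>l. \<Sum>u\<in>weak_comps {1..t + 1} (l - s). \<Sum>s'\<le>r. \<Sum>v\<in>weak_comps {1..t + 1} (r - s').
      w c * (shuffle_weight w c a a s s' * ?f t \<alpha> u v))"
    unfolding shared_value_sum_def sum_shared_values_Suc wc by (intro sum.cong refl f)
  also have "\<dots> = (\<Sum>c=1..a. \<Sum>s\<le>l. \<Sum>s'\<le>r. \<Sum>\<alpha>\<in>shared_values c t.
      \<Sum>u\<in>weak_comps {1..t + 1} (l - s). \<Sum>v\<in>weak_comps {1..t + 1} (r - s').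
      w c * (shuffle_weight w c a a s s' * ?f t \<alpha> u v))"
  proof (intro sum.cong refl)
    fix c
    let ?X = "\<lambda>\<alpha> s u s' v. w c * (shuffle_weight w c a a s s' * ?f t \<alpha> u v)"
    have "(\<Sum>\<alpha>\<in>shared_values c t. \<Sum>s\<le>l. \<Sum>u\<in>weak_comps {1..t + 1} (l - s).
         \<Sum>s'\<le>r. \<Sum>v\<in>weak_comps {1..t + 1} (r - s'). ?X \<alpha> s u s' v)
       = (\<Sum>\<alpha>\<in>shared_values c t. \<Sum>s\<le>l. \<Sum>s'\<le>r. \<Sum>u\<in>weak_comps {1..t + 1} (l - s).
          \<Sum>v\<in>weak_comps {1..t + 1} (r - s'). ?X \<alpha> s u s' v)"
      by (intro sum.cong refl sum.swap)
    also have "\<dots> = (\<Sum>s\<le>l. \<Sum>\<alpha>\<in>shared_values c t. \<Sum>s'\<le>r. \<Sum>u\<in>weak_comps {1..t + 1} (l - s).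
          \<Sum>v\<in>weak_comps {1..t + 1} (r - s'). ?X \<alpha> s u s' v)"
      by (rule sum.swap)
    also have "\<dots> = (\<Sum>s\<le>l. \<Sum>s'\<le>r. \<Sum>\<alpha>\<in>shared_values c t. \<Sum>u\<in>weak_comps {1..t + 1} (l - s).
          \<Sum>v\<in>weak_comps {1..t + 1} (r - s'). ?X \<alpha> s u s' v)"
      by (intro sum.cong refl sum.swap)
    finally show "(\<Sum>\<alpha>\<in>shared_values c t. \<Sum>s\<le>l. \<Sum>u\<in>weak_comps {1..t + 1} (l - s).
         \<Sum>s'\<le>r. \<Sum>v\<in>weak_comps {1..t + 1} (r - s'). ?X \<alpha> s u s' v) =
        (\<Sum>s\<le>l. \<Sum>s'\<le>r. \<Sum>\<alpha>\<in>shared_values c t. \<Sum>u\<in>weak_comps {1..t + 1} (l - s).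
          \<Sum>v\<in>weak_comps {1..t + 1} (r - s'). ?X \<alpha> s u s' v)" .
  qed
  finally show ?thesis by (simp only: shared_value_sum_def sum_distrib_left)
qed

lemma shared_value_sum_eq_pattern_weight: "1 \<le> a \<Longrightarrow> shared_value_sum w a t l r = pattern_weight w t l r a a"
proof (induction t arbitrary: a l r)
  case (Suc t)
  show ?case unfolding shared_value_sum_Suc using Suc.IH by (auto intro!: sum.cong)
qed (simp add: shared_value_sum_0)

lemma second_moment_eq:
  assumes "1 \<le> a" shows "second_moment p a n k = pair_moment (pmf p) n k k a a"
proof -
  have blk: "real ((u + v) choose u) * (\<Sum>x\<in>weak_comps {lo..hi} u. \<Sum>y\<in>weak_comps {lo..hi} v. \<Prod>j=lo..hi. pmf p j ^ (x j + y j))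
      = shuffle_weight (pmf p) lo hi hi u v" for lo hi u v
    by (simp add: shuffle_weight_def complete_hom_def sum_product power_add prod.distrib mult.assoc)
  have "second_moment p a n k = (\<Sum>t=0..k. real (n choose (2 * k - t)) * shared_value_sum (pmf p) a t (k - t) (k - t))"
    unfolding second_moment_def shared_value_sum_def blk ..
  also have "\<dots> = pair_moment (pmf p) n k k a a"
    unfolding pair_moment_def by (simp add: shared_value_sum_eq_pattern_weight[OF assms] atMost_atLeast0 mult_2)
  finally show ?thesis .
qed

text \<open>
  The upper bound \<open>b\<close> on the letters is what makes the count recursive in \<open>n\<close>.
\<close>

definition bounded_wis :: "(nat \<Rightarrow> nat) \<Rightarrow> nat \<Rightarrow> nat \<Rightarrow> nat \<Rightarrow> real" where
  "bounded_wis x n k b = real (card {S. S \<subseteq> {1..n} \<and> card S = k \<and> mono_on S x \<and> (\<forall>i\<in>S. x i \<le> b)})"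

lemma bounded_wis_0: "bounded_wis x n 0 b = 1"
proof -
  have "{S. S \<subseteq> {1..n} \<and> card S = 0 \<and> mono_on S x \<and> (\<forall>i\<in>S. x i \<le> b)} = {{}}"
    by (auto dest: finite_subset simp: monotone_on_def)
  thus ?thesis by (simp add: bounded_wis_def)
qed

lemma bounded_wis_empty: "bounded_wis x 0 (Suc k) b = 0"
proof -
  have "{S. S \<subseteq> {1..0::nat} \<and> card S = Suc k \<and> mono_on S x \<and> (\<forall>i\<in>S. x i \<le> b)} = {}"
    by auto
  thus ?thesis by (simp add: bounded_wis_def)
qed

lemma bounded_wis_upd: "bounded_wis (x(Suc n := y)) n k b = bounded_wis x n k b"
proof -
  have "mono_on S (x(Suc n := y)) = mono_on S x" "(\<forall>i\<in>S. (x(Suc n := y)) i \<le> b) = (\<forall>i\<in>S. x i \<le> b)"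
    if "S \<subseteq> {1..n}" for S
  proof -
    have *: "(x(Suc n := y)) i = x i" if "i \<in> S" for i using that \<open>S \<subseteq> {1..n}\<close> by auto
    show "mono_on S (x(Suc n := y)) = mono_on S x" unfolding monotone_on_def using * by simp
    show "(\<forall>i\<in>S. (x(Suc n := y)) i \<le> b) = (\<forall>i\<in>S. x i \<le> b)" using * by simp
  qed
  thus ?thesis unfolding bounded_wis_def by (intro arg_cong[where f = "\<lambda>A. real (card A)"]) blast
qed

text \<open>
  A subsequence that uses the last position has its largest letter there.
\<close>

lemma bounded_wis_Suc:
  "bounded_wis x (Suc n) (Suc k) b = bounded_wis x n (Suc k) b + (if x (Suc n) \<le> b then bounded_wis x n k (x (Suc n)) else 0)"
proof -
  define A where "A n k b = {S. S \<subseteq> {1..n} \<and> card S = k \<and> mono_on S x \<and> (\<forall>i\<in>S. x i \<le> b)}" for n k b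
  have fin: "finite (A n k b)" for n k b
    by (rule finite_subset[of _ "Pow {1..n}"]) (auto simp: A_def)
  define B where "B = (if x (Suc n) \<le> b then insert (Suc n) ` A n k (x (Suc n)) else {})"
  have mono_insert: "mono_on (insert (Suc n) S) x \<longleftrightarrow> mono_on S x \<and> (\<forall>i\<in>S. x i \<le> x (Suc n))"
    if "S \<subseteq> {1..n}" for S
    using that unfolding monotone_on_def by (auto dest: subsetD)
  have "A (Suc n) (Suc k) b = A n (Suc k) b \<union> B"
  proof (intro set_eqI iffI)
    fix S assume S: "S \<in> A (Suc n) (Suc k) b"
    show "S \<in> A n (Suc k) b \<union> B"
    proof (cases "Suc n \<in> S")
      case True
      define S' where "S' = S - {Suc n}"
      have S': "S = insert (Suc n) S'" "S' \<subseteq> {1..n}" "finite S'" "Suc n \<notin> S'"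
        using S True by (auto simp: S'_def A_def intro: finite_subset)
      have "S' \<in> A n k (x (Suc n))" "x (Suc n) \<le> b"
        using S S' mono_insert[OF S'(2)] by (auto simp: A_def)
      thus ?thesis using S'(1) by (auto simp: B_def)
    next
      case False
      have "i \<le> n" if "i \<in> S" for i
        using that False S by (cases "i = Suc n") (auto simp: A_def dest!: subsetD)
      thus ?thesis using S by (auto simp: A_def)
    qed
  next
    fix S assume "S \<in> A n (Suc k) b \<union> B"
    thus "S \<in> A (Suc n) (Suc k) b"
    proof
      assume "S \<in> B"
      then obtain S' where S': "S = insert (Suc n) S'" "S' \<in> A n k (x (Suc n))" "x (Suc n) \<le> b"
        by (auto simp: B_def split: if_splits)
      hence sub: "S' \<subseteq> {1..n}" by (simp add: A_def)
      hence "finite S'" "Suc n \<notin> S'" by (auto intro: finite_subset)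
      thus ?thesis using S' mono_insert[OF sub] by (force simp: A_def)
    qed (auto simp: A_def)
  qed
  moreover have "A n (Suc k) b \<inter> B = {}"
    by (auto simp: A_def B_def split: if_splits)
  moreover have "finite B" unfolding B_def using fin by auto
  moreover have "card B = (if x (Suc n) \<le> b then card (A n k (x (Suc n))) else 0)"
  proof -
    have "inj_on (insert (Suc n)) (A n k (x (Suc n)))"
      by (rule inj_onI) (auto simp: A_def dest!: subsetD insert_ident[THEN iffD1, rotated 2])
    thus ?thesis by (simp add: B_def card_image)
  qed
  ultimately show ?thesis
    unfolding bounded_wis_def A_def[symmetric] by (simp add: card_Un_disjoint fin)
qed

section \<open>First and second moments\<close>

context
  fixes p :: "nat pmf" assumes fin: "finite (set_pmf p)" and p0: "0 \<notin> set_pmf p"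
begin

definition iid :: "nat \<Rightarrow> (nat \<Rightarrow> nat) pmf" where "iid n = Pi_pmf {1..n} 0 (\<lambda>_. p)"

lemma finite_iid: "finite (set_pmf (iid n))"
  using fin by (auto simp: iid_def set_Pi_pmf)

lemma integrable_iid [simp]: "integrable (measure_pmf (iid n)) (F :: _ \<Rightarrow> real)"
  by (rule integrable_measure_pmf_finite[OF finite_iid])

lemma integrable_letter [simp]: "integrable (measure_pmf p) (F :: _ \<Rightarrow> real)"
  by (rule integrable_measure_pmf_finite[OF fin])

lemma expectation_iid_Suc:
  "measure_pmf.expectation (iid (Suc n)) F = measure_pmf.expectation p (\<lambda>y.
     measure_pmf.expectation (iid n) (\<lambda>x. F (x(Suc n := y)) :: real))"
proof -
  interpret finite_product "{1..Suc n}" "\<lambda>_. p" "0 :: nat"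
    using fin by unfold_locales auto
  have "{1..Suc n} - {Suc n} = {1..n}" by auto
  thus ?thesis using expect_split[of "Suc n" F] by (simp add: iid_def)
qed

lemma expectation_truncated:
  "measure_pmf.expectation p (\<lambda>y. if y \<le> b then f y else 0) = (\<Sum>c=1..b. pmf p c * f c :: real)"
  by (subst integral_measure_pmf_real[of "{1..b}"])
     (use p0 in \<open>auto simp: Suc_le_eq mult.commute split: if_splits intro!: gr0I sum.cong\<close>)

lemma expectation_bounded_wis:
  "measure_pmf.expectation (iid n) (\<lambda>x. bounded_wis x n k b) = real (n choose k) * complete_hom (pmf p) 1 b k"
proof (induction n arbitrary: k b)
  case 0
  show ?case by (cases k) (simp_all add: bounded_wis_0 bounded_wis_empty complete_hom_0)
next
  case (Suc n)
  show ?case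
  proof (cases k)
    case 0
    thus ?thesis by (simp add: bounded_wis_0 complete_hom_0)
  next
    case k: (Suc k')
    have "measure_pmf.expectation (iid n) (\<lambda>x. bounded_wis (x(Suc n := y)) (Suc n) (Suc k') b)
        = measure_pmf.expectation (iid n) (\<lambda>x. bounded_wis x n (Suc k') b)
         + (if y \<le> b then measure_pmf.expectation (iid n) (\<lambda>x. bounded_wis x n k' y) else 0)" for y
      by (simp add: bounded_wis_Suc bounded_wis_upd)
    hence "measure_pmf.expectation (iid (Suc n)) (\<lambda>x. bounded_wis x (Suc n) (Suc k') b)
        = real (n choose Suc k') * complete_hom (pmf p) 1 b (Suc k')
        + (\<Sum>c=1..b. pmf p c * (real (n choose k') * complete_hom (pmf p) 1 c k'))"
      unfolding expectation_iid_Suc by (simp add: expectation_truncated Suc.IH)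
    also have "(\<Sum>c=1..b. pmf p c * (real (n choose k') * complete_hom (pmf p) 1 c k'))
        = real (n choose k') * complete_hom (pmf p) 1 b (Suc k')"
      by (simp add: complete_hom_Suc sum_distrib_left mult_ac)
    finally show ?thesis by (simp add: k distrib_right)
  qed
qed

text \<open>
  The product of the recursions of the two counts has the four terms of \<open>pair_moment_Suc\<close>.
\<close>

lemma expectation_bounded_wis_mult:
  "measure_pmf.expectation (iid n) (\<lambda>x. bounded_wis x n k a * bounded_wis x n k' b) = pair_moment (pmf p) n k k' a b"
proof (induction n arbitrary: k k' a b)
  case 0
  have "pair_moment (pmf p) 0 (Suc l) (Suc l') a b = 0" for l l'
    unfolding pair_moment_def by (intro sum.neutral ballI) auto
  thus ?case
    by (cases k; cases k') (simp_all add: bounded_wis_0 bounded_wis_empty complete_hom_0 pair_moment_def shuffle_weight_def)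
next
  case (Suc n)
  show ?case
  proof (cases "k = 0 \<or> k' = 0")
    case True
    thus ?thesis
      by (auto simp: bounded_wis_0 expectation_bounded_wis pair_moment_def shuffle_weight_def complete_hom_0)
  next
    case False
    then obtain l l' where k: "k = Suc l" "k' = Suc l'" by (meson not0_implies_Suc)
    let ?E = "\<lambda>n. measure_pmf.expectation (iid n)"
    have "bounded_wis (x(Suc n := y)) (Suc n) k a * bounded_wis (x(Suc n := y)) (Suc n) k' b
        = bounded_wis x n k a * bounded_wis x n k' b
        + (if y \<le> a then bounded_wis x n l y * bounded_wis x n k' b else 0)
        + (if y \<le> b then bounded_wis x n k a * bounded_wis x n l' y else 0)
        + (if y \<le> min a b then bounded_wis x n l y * bounded_wis x n l' y else 0)" for x y
      by (simp add: k bounded_wis_Suc bounded_wis_upd algebra_simps)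
    hence "?E n (\<lambda>x. bounded_wis (x(Suc n := y)) (Suc n) k a * bounded_wis (x(Suc n := y)) (Suc n) k' b)
        = pair_moment (pmf p) n k k' a b
        + (if y \<le> a then pair_moment (pmf p) n l k' y b else 0)
        + (if y \<le> b then pair_moment (pmf p) n k l' a y else 0)
        + (if y \<le> min a b then pair_moment (pmf p) n l l' y y else 0)" for y
      by (simp add: Suc.IH)
    hence "?E (Suc n) (\<lambda>x. bounded_wis x (Suc n) k a * bounded_wis x (Suc n) k' b)
        = pair_moment (pmf p) n k k' a b
        + (\<Sum>c=1..a. pmf p c * pair_moment (pmf p) n l k' c b)
        + (\<Sum>c=1..b. pmf p c * pair_moment (pmf p) n k l' a c)
        + (\<Sum>c=1..min a b. pmf p c * pair_moment (pmf p) n l l' c c)"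
      unfolding expectation_iid_Suc by (simp only: expectation_truncated integrable_letter
          Bochner_Integration.integral_add measure_pmf.prob_space lebesgue_integral_const) simp
    thus ?thesis unfolding k pair_moment_Suc .
  qed
qed

end

section \<open>Differences and variance of the number of increasing subsequences\<close>

definition subsets_of_size :: "nat \<Rightarrow> nat \<Rightarrow> nat set set" where
  "subsets_of_size n k = {S. S \<subseteq> {1..n} \<and> card S = k}"

definition wis :: "nat \<Rightarrow> nat \<Rightarrow> (nat \<Rightarrow> nat) \<Rightarrow> real" where
  "wis n k x = (\<Sum>S\<in>subsets_of_size n k. of_bool (mono_on S x))"

lemma finite_subsets_of_size [simp]: "finite (subsets_of_size n k)"
  by (rule finite_subset[of _ "Pow {1..n}"]) (auto simp: subsets_of_size_def)

lemma sorted_map_iff_mono_on: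
  fixes "is" :: "nat list"
  assumes "sorted_wrt (<) is"
  shows "sorted (map x is) \<longleftrightarrow> mono_on (set is) (x :: nat \<Rightarrow> nat)"
  using assms
proof (induction "is")
  case (Cons i js)
  have "mono_on (insert i (set js)) x \<longleftrightarrow> (\<forall>j\<in>set js. x i \<le> x j) \<and> mono_on (set js) x"
    using Cons.prems unfolding monotone_on_def by (auto dest: less_imp_le)
  thus ?case using Cons by simp
qed (simp add: monotone_on_def)

lemma num_wis_eq_wis: "num_wis X n k \<omega> = wis n k (\<lambda>i. X i \<omega>)"
  unfolding num_wis_def wis_def
proof (rule sum.reindex_bij_witness[of _ sorted_list_of_set set])
  show "sorted_list_of_set (set is) = is" if "is \<in> inc_tuples n k" for "is"
    using that strict_sorted_equal[of "sorted_list_of_set (set is)" "is"]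
    by (simp add: inc_tuples_def)
  show "set is \<in> subsets_of_size n k" if "is \<in> inc_tuples n k" for "is"
    using that by (auto simp: inc_tuples_def subsets_of_size_def distinct_card strict_sorted_iff)
  fix S assume S: "S \<in> subsets_of_size n k"
  hence "finite S" by (auto simp: subsets_of_size_def intro: finite_subset)
  thus "set (sorted_list_of_set S) = S" by simp
  show "sorted_list_of_set S \<in> inc_tuples n k"
    using S \<open>finite S\<close> by (auto simp: inc_tuples_def subsets_of_size_def)
next
  fix "is" assume "is \<in> inc_tuples n k"
  thus "of_bool (mono_on (set is) (\<lambda>i. X i \<omega>)) = (of_bool (sorted (map (\<lambda>i. X i \<omega>) is)) :: real)"
    by (simp add: inc_tuples_def sorted_map_iff_mono_on)
qed

lemma wis_eq_bounded_wis:
  assumes "\<And>i. i \<in> {1..n} \<Longrightarrow> x i \<le> b"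
  shows "wis n k x = bounded_wis x n k b"
proof -
  have "{S. S \<subseteq> {1..n} \<and> card S = k \<and> mono_on S x \<and> (\<forall>i\<in>S. x i \<le> b)}
      = {S \<in> subsets_of_size n k. mono_on S x}"
    using assms by (auto simp: subsets_of_size_def)
  thus ?thesis by (simp add: wis_def bounded_wis_def of_bool_def sum.If_cases Int_def)
qed

lemma wis_cong: "(\<And>i. i \<in> {1..n} \<Longrightarrow> x i = y i) \<Longrightarrow> wis n k x = wis n k y"
proof -
  assume *: "\<And>i. i \<in> {1..n} \<Longrightarrow> x i = y i"
  have "mono_on S x = mono_on S y" if "S \<in> subsets_of_size n k" for S
  proof -
    have "x i = y i" if "i \<in> S" for i
      using that \<open>S \<in> subsets_of_size n k\<close> by (intro *) (auto simp: subsets_of_size_def)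
    thus ?thesis unfolding monotone_on_def by simp
  qed
  thus ?thesis unfolding wis_def by (intro sum.cong) auto
qed

text \<open>
  The remaining \<open>k - card T\<close> elements can be listed in at most \<open>n ^ (k - card T)\<close> ways. For \<open>k < card T\<close> there is
  no such set and the bound is 1.
\<close>

lemma card_subsets_containing:
  assumes "T \<subseteq> {1..n}"
  shows "card {S \<in> subsets_of_size n k. T \<subseteq> S} \<le> n ^ (k - card T)"
proof (cases "card T \<le> k")
  case True
  have fT: "finite T" using assms finite_subset by blast
  have "{S \<in> subsets_of_size n k. T \<subseteq> S} \<subseteq> (\<lambda>xs. T \<union> set xs) ` {xs. set xs \<subseteq> {1..n} \<and> length xs = k - card T}"
  proof
    fix S assume S: "S \<in> {S \<in> subsets_of_size n k. T \<subseteq> S}"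
    hence fS: "finite S" by (auto simp: subsets_of_size_def intro: finite_subset)
    hence "set (sorted_list_of_set (S - T)) = S - T" "length (sorted_list_of_set (S - T)) = k - card T"
      using S fT by (auto simp: subsets_of_size_def card_Diff_subset)
    thus "S \<in> (\<lambda>xs. T \<union> set xs) ` {xs. set xs \<subseteq> {1..n} \<and> length xs = k - card T}"
      using S by (intro image_eqI[of _ _ "sorted_list_of_set (S - T)"]) (auto simp: subsets_of_size_def)
  qed
  hence "card {S \<in> subsets_of_size n k. T \<subseteq> S}
      \<le> card ((\<lambda>xs. T \<union> set xs) ` {xs. set xs \<subseteq> {1..n} \<and> length xs = k - card T})"
    by (intro card_mono finite_imageI finite_lists_length_eq) auto
  also have "\<dots> \<le> card {xs. set xs \<subseteq> {1..n} \<and> length xs = k - card T}"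
    by (intro card_image_le finite_lists_length_eq) auto
  also have "\<dots> = n ^ (k - card T)" by (simp add: card_lists_length_eq)
  finally show ?thesis .
next
  case False
  have "{S \<in> subsets_of_size n k. T \<subseteq> S} = {}"
    using False by (auto simp: subsets_of_size_def dest: card_mono[OF finite_subset, rotated 1, OF finite_atLeastAtMost])
  thus ?thesis by (simp only: card.empty)
qed

lemma mono_on_upd: "i \<notin> S \<Longrightarrow> mono_on S (x(i := y)) = mono_on S x"
  unfolding monotone_on_def by auto

lemma wis_diff:
  "wis n k x - wis n k (x(i := y)) =
     (\<Sum>S\<in>{S \<in> subsets_of_size n k. {i} \<subseteq> S}. of_bool (mono_on S x) - of_bool (mono_on S (x(i := y))))"
  unfolding wis_def sum_subtractf[symmetric]
  by (rule sum.mono_neutral_right) (auto simp: mono_on_upd)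

lemma abs_sum_of_bool_le:
  assumes "finite A" "card A \<le> N" "\<And>a. a \<in> A \<Longrightarrow> \<bar>f a\<bar> \<le> (c :: real)" "0 \<le> c"
  shows "\<bar>sum f A\<bar> \<le> c * real N"
proof -
  have "\<bar>sum f A\<bar> \<le> (\<Sum>a\<in>A. c)" using assms(3) by (intro order_trans[OF sum_abs] sum_mono) auto
  also have "\<dots> \<le> c * real N" using assms by (simp add: mult.commute mult_left_mono)
  finally show ?thesis .
qed

lemma wis_diff_bound:
  assumes "i \<in> {1..n}" shows "\<bar>wis n k x - wis n k (x(i := y))\<bar> \<le> real (n ^ (k - 1))"
  unfolding wis_diff
  using abs_sum_of_bool_le[OF _ card_subsets_containing[of "{i}" n k], of _ 1] assms by simp

lemma wis_second_diff_bound: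
  assumes "i \<in> {1..n}" "j \<in> {1..n}" "i \<noteq> j"
  shows "\<bar>wis n k x - wis n k (x(i := y)) - wis n k (x(j := v)) + wis n k (x(i := y, j := v))\<bar>
    \<le> 2 * real (n ^ (k - 2))"
proof -
  let ?f = "\<lambda>S. of_bool (mono_on S x) - of_bool (mono_on S (x(i := y))) - of_bool (mono_on S (x(j := v)))
      + of_bool (mono_on S (x(i := y, j := v))) :: real"
  have "wis n k x - wis n k (x(i := y)) - wis n k (x(j := v)) + wis n k (x(i := y, j := v)) = sum ?f (subsets_of_size n k)"
    by (simp add: wis_def sum.distrib sum_subtractf)
  also have "\<dots> = sum ?f {S \<in> subsets_of_size n k. {i, j} \<subseteq> S}"
  proof (rule sum.mono_neutral_right)
    have "?f S = 0" if "\<not> {i, j} \<subseteq> S" for S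
    proof (cases "j \<in> S")
      case True
      thus ?thesis using that unfolding fun_upd_twist[OF assms(3), of x y v] by (simp add: mono_on_upd)
    qed (simp add: mono_on_upd)
    thus "\<forall>S\<in>subsets_of_size n k - {S \<in> subsets_of_size n k. {i, j} \<subseteq> S}. ?f S = 0" by blast
  qed auto
  also have "\<bar>\<dots>\<bar> \<le> 2 * real (n ^ (k - card {i, j}))"
    using assms by (intro abs_sum_of_bool_le card_subsets_containing) auto
  finally show ?thesis using assms by (simp add: numeral_2_eq_2)
qed

context finite_product
begin

text \<open>
  This is the nonnegativity of the square in \<open>expect_sum_dev_minus_sq\<close>, applied to the centred function.
\<close>

lemma variance_ge:
  "(\<Sum>i\<in>I. expect (\<lambda>x. (dev i F x)\<^sup>2)) - (\<Sum>i\<in>I. \<Sum>j\<in>I - {i}. expect (\<lambda>x. (dev i (dev j F) x)\<^sup>2))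
    \<le> expect (\<lambda>x. (F x - expect F)\<^sup>2)"
proof -
  have dev: "dev i (\<lambda>x. F x - expect F) = dev i F" for i by (rule ext) (simp add: dev_eq)
  have "0 \<le> expect (\<lambda>x. ((\<Sum>i\<in>I. dev i (\<lambda>x. F x - expect F) x) - (F x - expect F))\<^sup>2)"
    by (intro integral_nonneg_AE) auto
  thus ?thesis unfolding expect_sum_dev_minus_sq unfolding dev by linarith
qed

text \<open>
  With the other letters fixed, the deviations at the letters \<open>u\<close> and \<open>v\<close> differ by as much as \<open>F\<close> does,
  so that their squares sum to at least half of the squared difference.
\<close>

lemma expect_dev_sq_ge:
  assumes i: "i \<in> I" and uv: "u \<noteq> v"
  shows "min (pmf (p i) u) (pmf (p i) v) / 2 * (expect (\<lambda>x. F (x(i := u)) - F (x(i := v))))\<^sup>2 \<le> expect (\<lambda>x. (dev i F x)\<^sup>2)"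
proof -
  let ?m = "min (pmf (p i) u) (pmf (p i) v)" and ?d = "\<lambda>x. F (x(i := u)) - F (x(i := v))"
  have "?m / 2 * (?d x)\<^sup>2 \<le> cond_mean i (\<lambda>x. (dev i F x)\<^sup>2) x" for x
  proof -
    let ?G = "\<lambda>y. (dev i F (x(i := y)))\<^sup>2"
    have Dd: "?d x = dev i F (x(i := u)) - dev i F (x(i := v))" by (simp add: dev_def cond_mean_upd)
    have "(s - t)\<^sup>2 \<le> 2 * (s\<^sup>2 + t\<^sup>2)" for s t :: real
      using zero_le_power2[of "s + t"] by (simp add: power2_eq_square algebra_simps)
    hence "(?d x)\<^sup>2 \<le> 2 * (?G u + ?G v)" unfolding Dd .
    hence "?m / 2 * (?d x)\<^sup>2 \<le> ?m / 2 * (2 * (?G u + ?G v))"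
      by (intro mult_left_mono) auto
    also have "\<dots> = ?m * ?G u + ?m * ?G v" by (simp add: distrib_left)
    also have "\<dots> \<le> pmf (p i) u * ?G u + pmf (p i) v * ?G v"
      by (intro add_mono mult_right_mono) auto
    also have "\<dots> = (\<Sum>y\<in>{u, v}. ?G y * pmf (p i) y)" using uv by (simp add: mult.commute)
    also have "\<dots> \<le> (\<Sum>y\<in>set_pmf (p i) \<union> {u, v}. ?G y * pmf (p i) y)"
      using finite_p by (intro sum_mono2) auto
    also have "\<dots> = cond_mean i (\<lambda>x. (dev i F x)\<^sup>2) x"
      unfolding cond_mean_def using finite_p by (subst integral_measure_pmf_real) auto
    finally show ?thesis .
  qed
  hence "expect (\<lambda>x. ?m / 2 * (?d x)\<^sup>2) \<le> expect (cond_mean i (\<lambda>x. (dev i F x)\<^sup>2))" by (rule expect_mono)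
  hence "?m / 2 * expect (\<lambda>x. (?d x)\<^sup>2) \<le> expect (\<lambda>x. (dev i F x)\<^sup>2)" by (simp add: expect_cond_mean[OF i])
  moreover have "(expect ?d)\<^sup>2 \<le> expect (\<lambda>x. (?d x)\<^sup>2)"
  proof -
    define m where "m = expect ?d"
    have "0 \<le> expect (\<lambda>x. (?d x - m)\<^sup>2)" by (intro integral_nonneg_AE) auto
    also have "\<dots> = expect (\<lambda>x. (?d x)\<^sup>2 - 2 * m * ?d x + m\<^sup>2)"
      by (intro arg_cong[where f = expect] ext) (simp add: power2_eq_square algebra_simps)
    also have "\<dots> = expect (\<lambda>x. (?d x)\<^sup>2) - 2 * m * expect ?d + m\<^sup>2" by simp
    finally show ?thesis unfolding m_def[symmetric] by (simp add: power2_eq_square)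
  qed
  hence "?m / 2 * (expect ?d)\<^sup>2 \<le> ?m / 2 * expect (\<lambda>x. (?d x)\<^sup>2)" by (intro mult_left_mono) auto
  ultimately show ?thesis by linarith
qed

end

text \<open>
  Raising letter \<open>i\<close> never destroys a subsequence that ends at \<open>i\<close>, and it creates one on every set of
  positions with largest element \<open>i\<close> whose other letters all equal the new value \<open>b\<close>; here \<open>2 \<le> k\<close> provides such another
  position. Subsequences that continue beyond \<open>i\<close> may be lost, but there are few of them when \<open>i\<close> is
  close to \<open>n\<close>.
\<close>

lemma wis_letter_diff_ge:
  assumes ab: "a < b" and k: "2 \<le> k" and i: "i \<in> {1..n}"
  shows "wis n k (x(i := b)) - wis n k (x(i := a)) \<ge>
    (\<Sum>S\<in>{S \<in> subsets_of_size n k. i \<in> S \<and> S \<subseteq> {1..i}}. of_bool (\<forall>j\<in>S - {i}. x j = b)) - real ((n - i) * n ^ (k - 2))"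
proof -
  let ?f = "\<lambda>S. of_bool (mono_on S (x(i := b))) - of_bool (mono_on S (x(i := a))) :: real"
  let ?T = "{S \<in> subsets_of_size n k. i \<in> S}"
  let ?T1 = "{S \<in> subsets_of_size n k. i \<in> S \<and> S \<subseteq> {1..i}}"
  let ?T2 = "{S \<in> subsets_of_size n k. i \<in> S \<and> \<not> S \<subseteq> {1..i}}"
  have "wis n k (x(i := b)) - wis n k (x(i := a)) = sum ?f ?T"
    unfolding wis_def sum_subtractf[symmetric] by (rule sum.mono_neutral_right) (auto simp: mono_on_upd)
  also have "\<dots> = sum ?f (?T1 \<union> ?T2)" by (rule sum.cong) auto
  also have "\<dots> = sum ?f ?T1 + sum ?f ?T2" by (rule sum.union_disjoint) auto
  also have "\<dots> \<ge> (\<Sum>S\<in>?T1. of_bool (\<forall>j\<in>S - {i}. x j = b)) - real ((n - i) * n ^ (k - 2))"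
  proof -
    have "(\<Sum>S\<in>?T1. of_bool (\<forall>j\<in>S - {i}. x j = b)) \<le> sum ?f ?T1"
    proof (rule sum_mono)
      fix S assume S: "S \<in> ?T1"
      have le: "j \<le> i" if "j \<in> S" for j using S that by auto
      have imp: "mono_on S (x(i := b))" if "mono_on S (x(i := a))"
        unfolding monotone_on_def
      proof (intro ballI impI)
        fix r s assume rs: "r \<in> S" "s \<in> S" "r \<le> s"
        hence "(x(i := a)) r \<le> (x(i := a)) s" using that unfolding monotone_on_def by blast
        thus "(x(i := b)) r \<le> (x(i := b)) s"
          using rs le[of s] ab by (auto split: if_splits)
      qed
      show "of_bool (\<forall>j\<in>S - {i}. x j = b) \<le> ?f S"
      proof (cases "\<forall>j\<in>S - {i}. x j = b")
        case True
        have "mono_on S (x(i := b))" unfolding monotone_on_def using True by auto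
        moreover have "\<not> mono_on S (x(i := a))"
        proof
          assume m: "mono_on S (x(i := a))"
          have "card S = k" using S by (auto simp: subsets_of_size_def)
          hence "\<not> S \<subseteq> {i}" using k card_mono[of "{i}" S] by auto
          then obtain j where j: "j \<in> S" "j \<noteq> i" by auto
          hence "(x(i := a)) j \<le> (x(i := a)) i"
            using m le[of j] S unfolding monotone_on_def by blast
          thus False using j True ab by auto
        qed
        ultimately show ?thesis by auto
      next
        case False
        thus ?thesis using imp by (auto simp: of_bool_def)
      qed
    qed
    moreover have "- real ((n - i) * n ^ (k - 2)) \<le> sum ?f ?T2"
    proof -
      have "?T2 \<subseteq> (\<Union>j\<in>{i<..n}. {S \<in> subsets_of_size n k. {i, j} \<subseteq> S})"
      proof
        fix S assume S: "S \<in> ?T2"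
        then obtain j where "j \<in> S" "j \<notin> {1..i}" by blast
        moreover have "j \<in> {1..n}" using S \<open>j \<in> S\<close> by (auto simp: subsets_of_size_def)
        ultimately show "S \<in> (\<Union>j\<in>{i<..n}. {S \<in> subsets_of_size n k. {i, j} \<subseteq> S})"
          using S by (intro UN_I[of j]) auto
      qed
      hence "card ?T2 \<le> card (\<Union>j\<in>{i<..n}. {S \<in> subsets_of_size n k. {i, j} \<subseteq> S})"
        by (intro card_mono) auto
      also have "\<dots> \<le> (\<Sum>j\<in>{i<..n}. card {S \<in> subsets_of_size n k. {i, j} \<subseteq> S})"
        by (rule card_UN_le) simp
      also have "\<dots> \<le> (\<Sum>j\<in>{i<..n}. n ^ (k - 2))"
      proof (rule sum_mono)
        fix j assume j: "j \<in> {i<..n}"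
        hence "card {i, j} = 2" by simp
        thus "card {S \<in> subsets_of_size n k. {i, j} \<subseteq> S} \<le> n ^ (k - 2)"
          using card_subsets_containing[of "{i, j}" n k] i j by simp
      qed
      finally have c: "card ?T2 \<le> (n - i) * n ^ (k - 2)" by simp
      have "\<bar>sum ?f ?T2\<bar> \<le> 1 * real ((n - i) * n ^ (k - 2))"
        by (rule abs_sum_of_bool_le[OF _ c]) auto
      thus ?thesis by linarith
    qed
    ultimately show ?thesis by linarith
  qed
  finally show ?thesis .
qed

lemma card_subsets_with_max_ge:
  assumes "i \<in> {1..n}" "1 \<le> k"
  shows "(i - 1) choose (k - 1) \<le> card {S \<in> subsets_of_size n k. i \<in> S \<and> S \<subseteq> {1..i}}"
proof -
  let ?A = "{S. S \<subseteq> {1..i - 1} \<and> card S = k - 1}"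
  have "insert i ` ?A \<subseteq> {S \<in> subsets_of_size n k. i \<in> S \<and> S \<subseteq> {1..i}}"
  proof
    fix S assume "S \<in> insert i ` ?A"
    then obtain S' where S': "S = insert i S'" "S' \<subseteq> {1..i - 1}" "card S' = k - 1" by auto
    have "finite S'" "i \<notin> S'" using S'(2) assms by (auto intro: finite_subset)
    thus "S \<in> {S \<in> subsets_of_size n k. i \<in> S \<and> S \<subseteq> {1..i}}"
      using S' assms by (fastforce simp: subsets_of_size_def)
  qed
  hence "card (insert i ` ?A) \<le> card {S \<in> subsets_of_size n k. i \<in> S \<and> S \<subseteq> {1..i}}"
    by (intro card_mono) auto
  moreover have "inj_on (insert i) ?A"
  proof (rule inj_onI)
    fix S S' assume "S \<in> ?A" "S' \<in> ?A" "insert i S = insert i S'"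
    moreover have "i \<notin> {1..i - 1}" using assms by auto
    ultimately show "S = S'" by (metis (no_types, lifting) insert_ident mem_Collect_eq subsetD)
  qed
  ultimately show ?thesis by (simp add: card_image n_subsets)
qed

lemma expectation_all_equal:
  assumes A: "finite A" "T \<subseteq> A" and fin: "finite (set_pmf p)"
  shows "measure_pmf.expectation (Pi_pmf A d (\<lambda>_. p)) (\<lambda>x. of_bool (\<forall>j\<in>T. x j = b)) = pmf p b ^ card T"
proof -
  let ?f = "\<lambda>j y. if j \<in> T then of_bool (y = b) else 1 :: real"
  have "of_bool (\<forall>j\<in>T. x j = b) = (\<Prod>j\<in>A. ?f j (x j))" for x
  proof (cases "\<forall>j\<in>T. x j = b")
    case False
    then obtain j where "j \<in> T" "x j \<noteq> b" by auto
    hence "(\<Prod>j\<in>A. ?f j (x j)) = 0" using A by (intro prod_zero) auto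
    thus ?thesis using False by simp
  qed (simp add: prod.neutral)
  moreover have "measure_pmf.expectation p (?f j) = (if j \<in> T then pmf p b else 1)" for j
  proof -
    have "(\<lambda>y. of_bool (y = b) :: real) = indicator {b}" by (auto simp: indicator_def)
    thus ?thesis by (simp add: measure_pmf_single)
  qed
  moreover have "measure_pmf.expectation (Pi_pmf A d (\<lambda>_. p)) (\<lambda>x. \<Prod>j\<in>A. ?f j (x j))
      = (\<Prod>j\<in>A. measure_pmf.expectation p (?f j))"
    using A fin by (intro expectation_prod_Pi_pmf) (auto intro: integrable_measure_pmf_finite)
  moreover have "(\<Prod>j\<in>A. if j \<in> T then pmf p b else 1) = pmf p b ^ card T"
    using A by (subst prod.If_cases) (auto simp: Int_absorb1)
  ultimately show ?thesis by simp
qed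

lemma expectation_letter_diff_ge:
  assumes fin: "finite (set_pmf p)" and ab: "a < b" and k: "2 \<le> k" and i: "i \<in> {1..n}"
  shows "real ((i - 1) choose (k - 1)) * pmf p b ^ (k - 1) - real ((n - i) * n ^ (k - 2))
    \<le> measure_pmf.expectation (Pi_pmf {1..n} 0 (\<lambda>_. p)) (\<lambda>x. wis n k (x(i := b)) - wis n k (x(i := a)))"
proof -
  interpret finite_product "{1..n}" "\<lambda>_. p" "0 :: nat" using fin by unfold_locales auto
  let ?T1 = "{S \<in> subsets_of_size n k. i \<in> S \<and> S \<subseteq> {1..i}}"
  let ?q = "pmf p b ^ (k - 1)"
  have "expect (\<lambda>x. of_bool (\<forall>j\<in>S - {i}. x j = b)) = ?q" if "S \<in> ?T1" for S
  proof -
    have S: "S \<subseteq> {1..n}" "card S = k" "i \<in> S" using that by (auto simp: subsets_of_size_def)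
    hence "card (S - {i}) = k - 1" by (simp add: card_Diff_singleton)
    thus ?thesis using S fin by (subst expectation_all_equal) auto
  qed
  hence "real (card ?T1) * ?q - real ((n - i) * n ^ (k - 2))
     = expect (\<lambda>x. (\<Sum>S\<in>?T1. of_bool (\<forall>j\<in>S - {i}. x j = b)) - real ((n - i) * n ^ (k - 2)))"
    by (subst Bochner_Integration.integral_diff) (simp_all only: integrable_joint Bochner_Integration.integral_sum, simp_all)
  also have "\<dots> \<le> expect (\<lambda>x. wis n k (x(i := b)) - wis n k (x(i := a)))"
    by (intro expect_mono wis_letter_diff_ge assms)
  finally have "real (card ?T1) * ?q - real ((n - i) * n ^ (k - 2))
      \<le> expect (\<lambda>x. wis n k (x(i := b)) - wis n k (x(i := a)))" .
  moreover have "real ((i - 1) choose (k - 1)) * ?q \<le> real (card ?T1) * ?q"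
    using card_subsets_with_max_ge[OF i, of k] k by (intro mult_right_mono) auto
  ultimately show ?thesis by linarith
qed

abbreviation wis_variance :: "nat pmf \<Rightarrow> nat \<Rightarrow> nat \<Rightarrow> real" where
  "wis_variance p n k \<equiv> measure_pmf.variance (Pi_pmf {1..n} 0 (\<lambda>_. p)) (wis n k)"

lemma wis_variance_ge:
  assumes fin: "finite (set_pmf p)" and ab: "a < b" and k: "2 \<le> k"
    and J: "J \<subseteq> {1..n}" and L: "0 \<le> L"
    and d: "\<And>i. i \<in> J \<Longrightarrow> L \<le> real ((i - 1) choose (k - 1)) * pmf p b ^ (k - 1) - real ((n - i) * n ^ (k - 2))"
  shows "real (card J) * (min (pmf p a) (pmf p b) / 2 * L\<^sup>2) - 4 * (real n ^ (k - 1))\<^sup>2 \<le> wis_variance p n k"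
proof -
  interpret finite_product "{1..n}" "\<lambda>_. p" "0 :: nat" using fin by unfold_locales auto
  let ?F = "wis n k" and ?m = "min (pmf p a) (pmf p b)"
  have "real (card J) * (?m / 2 * L\<^sup>2) = (\<Sum>i\<in>J. ?m / 2 * L\<^sup>2)" by simp
  also have "\<dots> \<le> (\<Sum>i\<in>J. expect (\<lambda>x. (dev i ?F x)\<^sup>2))"
  proof (rule sum_mono)
    fix i assume i: "i \<in> J"
    hence i': "i \<in> {1..n}" using J by auto
    have "L \<le> expect (\<lambda>x. ?F (x(i := b)) - ?F (x(i := a)))"
      using d[OF i] expectation_letter_diff_ge[OF fin ab k i'] by linarith
    hence "?m / 2 * L\<^sup>2 \<le> ?m / 2 * (expect (\<lambda>x. ?F (x(i := b)) - ?F (x(i := a))))\<^sup>2"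
      using L by (intro mult_left_mono power_mono) auto
    also have "\<dots> \<le> expect (\<lambda>x. (dev i ?F x)\<^sup>2)"
      using expect_dev_sq_ge[OF i', of b a ?F] ab by (simp add: min.commute)
    finally show "?m / 2 * L\<^sup>2 \<le> expect (\<lambda>x. (dev i ?F x)\<^sup>2)" .
  qed
  also have "\<dots> \<le> (\<Sum>i\<in>{1..n}. expect (\<lambda>x. (dev i ?F x)\<^sup>2))"
    using J by (intro sum_mono2) (auto intro!: integral_nonneg_AE)
  finally have 1: "real (card J) * (?m / 2 * L\<^sup>2) \<le> (\<Sum>i\<in>{1..n}. expect (\<lambda>x. (dev i ?F x)\<^sup>2))" .
  let ?c = "2 * real (n ^ (k - 2))"
  have "(\<Sum>i\<in>{1..n}. \<Sum>j\<in>{1..n} - {i}. expect (\<lambda>x. (dev i (dev j ?F) x)\<^sup>2)) \<le> (\<Sum>i\<in>{1..n}. \<Sum>j\<in>{1..n} - {i}. ?c\<^sup>2)"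
  proof (intro sum_mono expect_sq_bound)
    fix i j x assume "i \<in> {1..n}" "j \<in> {1..n} - {i}"
    thus "\<bar>dev i (dev j ?F) x\<bar> \<le> ?c" by (intro dev_dev_bound wis_second_diff_bound) auto
  qed
  also have "\<dots> \<le> (\<Sum>i\<in>{1..n}. \<Sum>j\<in>{1..n}. ?c\<^sup>2)"
    by (intro sum_mono sum_mono2) auto
  also have "\<dots> = (real n * ?c)\<^sup>2" by (simp add: power2_eq_square)
  also have "real n * ?c = 2 * real n ^ (k - 1)"
  proof -
    have "k - 1 = Suc (k - 2)" using k by simp
    thus ?thesis by (simp only: power_Suc of_nat_power mult_ac)
  qed
  finally have "(\<Sum>i\<in>{1..n}. \<Sum>j\<in>{1..n} - {i}. expect (\<lambda>x. (dev i (dev j ?F) x)\<^sup>2)) \<le> 4 * (real n ^ (k - 1))\<^sup>2"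
    by (simp add: power2_eq_square)
  thus ?thesis using 1 variance_ge[of ?F] by linarith
qed

text \<open>
  The last \<open>\<epsilon> * n\<close> positions suffice. At each of them the mean effect of raising the letter from \<open>a\<close>
  to \<open>b\<close> is at least \<open>\<epsilon> * n ^ (k - 1)\<close>: the gain is twice that, by \<open>m choose K \<ge> (m / K) ^ K\<close> with
  \<open>m \<ge> n / 2\<close>, and the loss at most that.
\<close>

lemma wis_variance_growth:
  assumes fin: "finite (set_pmf p)" and ab: "a < b" "a \<in> set_pmf p" "b \<in> set_pmf p" and k: "2 \<le> k"
  shows "\<exists>c>0. \<exists>N. \<forall>n\<ge>N. c * real n * (real n ^ (k - 1))\<^sup>2 \<le> wis_variance p n k"
proof -
  define K where "K = k - 1"
  have K: "1 \<le> K" "k - 2 = K - 1" using k by (auto simp: K_def)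
  define q where "q = pmf p b ^ K"
  define \<mu> where "\<mu> = min (pmf p a) (pmf p b)"
  define \<kappa> where "\<kappa> = (1 / (2 * real K)) ^ K"
  define \<epsilon> where "\<epsilon> = \<kappa> * q / 2"
  have q: "0 < q" "q \<le> 1" using ab pmf_le_1 by (auto simp: q_def pmf_positive intro!: power_le_one)
  have \<mu>: "0 < \<mu>" using ab by (auto simp: \<mu>_def pmf_positive)
  have \<kappa>: "0 < \<kappa>" "\<kappa> \<le> 1" using K by (auto simp: \<kappa>_def intro!: power_le_one)
  have \<epsilon>: "0 < \<epsilon>" "\<epsilon> \<le> 1 / 2" using q \<kappa> mult_mono[of \<kappa> 1 q 1] by (auto simp: \<epsilon>_def)
  define c where "c = \<mu> * \<epsilon> ^ 3 / 8"
  \<comment> \<open>These thresholds ensure \<open>K \<le> n / 2\<close>, at least \<open>\<epsilon> * n / 2\<close> positions, and that half of the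
     main term absorbs the mixed deviations.\<close>
  define N where "N = nat \<lceil>max (2 * real K) (max (2 / \<epsilon>) (4 / c))\<rceil>"
  have c: "0 < c" using \<mu> \<epsilon> by (simp add: c_def)
  have "c * real n * (real n ^ K)\<^sup>2 \<le> wis_variance p n k" if n: "N \<le> n" for n
  proof -
    have n': "2 * real K \<le> n" "2 / \<epsilon> \<le> n" "4 / c \<le> n"
      using n unfolding N_def by linarith+
    have n1: "1 \<le> n" using n'(1) K by linarith
    define m where "m = nat \<lfloor>\<epsilon> * n\<rfloor>"
    have m: "real m \<le> \<epsilon> * n" "\<epsilon> * n - 1 \<le> real m" using \<epsilon> by (auto simp: m_def)
    have "\<epsilon> * n \<le> 1 / 2 * n" using \<epsilon> by (intro mult_right_mono) auto
    hence nm: "real n / 2 \<le> real n - real m" "m \<le> n" using m by auto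
    have L: "\<epsilon> * real n ^ K \<le> real ((i - 1) choose (k - 1)) * pmf p b ^ (k - 1) - real ((n - i) * n ^ (k - 2))"
      if i: "i \<in> {n - m<..n}" for i
    proof -
      have i1: "real n / 2 \<le> real (i - 1)" using i nm by (auto simp: of_nat_diff)
      hence Ki: "K \<le> i - 1" using n'(1) by linarith
      have "\<kappa> * real n ^ K = (real n / 2 / real K) ^ K"
        by (simp add: \<kappa>_def power_divide power_mult_distrib)
      also have "\<dots> \<le> (real (i - 1) / real K) ^ K"
        using i1 by (intro power_mono divide_right_mono) auto
      also have "\<dots> \<le> real ((i - 1) choose K)"
        using Ki by (rule binomial_ge_n_over_k_pow_k)
      finally have "\<kappa> * real n ^ K * q \<le> real ((i - 1) choose K) * q"
        using q by (intro mult_right_mono) auto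
      moreover have "real ((n - i) * n ^ (k - 2)) \<le> \<epsilon> * real n ^ K"
      proof -
        have "real (n - i) \<le> \<epsilon> * n" using i m by (auto simp: of_nat_diff)
        hence "real (n - i) * real n ^ (K - 1) \<le> \<epsilon> * n * real n ^ (K - 1)"
          by (intro mult_right_mono) auto
        also have "\<dots> = \<epsilon> * real n ^ K" using K by (simp add: power_eq_if[of _ K])
        finally show ?thesis using K by simp
      qed
      moreover have "\<kappa> * real n ^ K * q = 2 * (\<epsilon> * real n ^ K)" by (simp add: \<epsilon>_def)
      ultimately show ?thesis unfolding q_def K_def[symmetric] by linarith
    qed
    have "real (card {n - m<..n}) * (\<mu> / 2 * (\<epsilon> * real n ^ K)\<^sup>2) - 4 * (real n ^ (k - 1))\<^sup>2 \<le> wis_variance p n k"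
      unfolding \<mu>_def using \<epsilon> by (intro wis_variance_ge[OF fin ab(1) k] L) auto
    hence V: "real m * (\<mu> / 2 * (\<epsilon> * real n ^ K)\<^sup>2) - 4 * (real n ^ K)\<^sup>2 \<le> wis_variance p n k"
      using nm by (simp add: K_def)
    have "2 \<le> \<epsilon> * n" using n'(2) \<epsilon> by (simp add: field_simps)
    hence "\<epsilon> * n / 2 \<le> real m" using m by linarith
    hence "\<epsilon> * n / 2 * (\<mu> / 2 * (\<epsilon> * real n ^ K)\<^sup>2) \<le> real m * (\<mu> / 2 * (\<epsilon> * real n ^ K)\<^sup>2)"
      using \<mu> by (intro mult_right_mono) auto
    moreover have "\<epsilon> * n / 2 * (\<mu> / 2 * (\<epsilon> * real n ^ K)\<^sup>2) = 2 * (c * n * (real n ^ K)\<^sup>2)"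
      by (simp add: c_def power2_eq_square power3_eq_cube)
    moreover have "4 * (real n ^ K)\<^sup>2 \<le> c * n * (real n ^ K)\<^sup>2"
      using n'(3) c by (intro mult_right_mono) (auto simp: field_simps)
    ultimately show ?thesis using V by linarith
  qed
  thus ?thesis using c unfolding K_def by blast
qed

text \<open>
  With \<open>\<theta>\<close> the ratio of \<open>n ^ (k - 1)\<close> to the standard deviation, the standardised count has first differences
  at most \<open>\<theta>\<close> and second differences at most \<open>2 * \<theta> / n\<close>, and \<open>\<theta>\<^sup>2 \<le> 1 / (c * n)\<close>.
\<close>

theorem wis_berry_esseen:
  assumes fin: "finite (set_pmf p)" and ab: "a < b" "a \<in> set_pmf p" "b \<in> set_pmf p" and k: "2 \<le> k"
  shows "\<exists>C N. \<forall>n\<ge>N. 0 < wis_variance p n k \<and> (\<forall>z.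
    \<bar>measure_pmf.expectation (Pi_pmf {1..n} 0 (\<lambda>_. p)) (\<lambda>x. of_bool ((wis n k x -
        measure_pmf.expectation (Pi_pmf {1..n} 0 (\<lambda>_. p)) (wis n k)) / sqrt (wis_variance p n k) \<le> z)) - Phi z\<bar>
      \<le> C / sqrt n)"
proof -
  obtain c N where c: "0 < c" and N: "\<And>n. N \<le> n \<Longrightarrow> c * real n * (real n ^ (k - 1))\<^sup>2 \<le> wis_variance p n k"
    using wis_variance_growth[OF assms] by blast
  define C where "C = 2 * (4 / c + 2 / sqrt c + 9 / c)"
  have "0 < wis_variance p n k \<and> (\<forall>z.
    \<bar>measure_pmf.expectation (Pi_pmf {1..n} 0 (\<lambda>_. p)) (\<lambda>x. of_bool ((wis n k x -
        measure_pmf.expectation (Pi_pmf {1..n} 0 (\<lambda>_. p)) (wis n k)) / sqrt (wis_variance p n k) \<le> z)) - Phi z\<bar>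
      \<le> C / sqrt n)" if n: "max 1 N \<le> n" for n
  proof -
    interpret finite_product "{1..n}" "\<lambda>_. p" "0 :: nat" using fin by unfold_locales auto
    note integrable_joint[simplified, simp]
    define V where "V = wis_variance p n k"
    define \<sigma> where "\<sigma> = sqrt V"
    define E where "E = expect (wis n k)"
    define F where "F = (\<lambda>x. (wis n k x - E) / \<sigma>)"
    define \<theta> where "\<theta> = real n ^ (k - 1) / \<sigma>"
    have n1: "1 \<le> n" "N \<le> n" using n by auto
    have VN: "c * n * (real n ^ (k - 1))\<^sup>2 \<le> V" using N[OF n1(2)] by (simp add: V_def)
    have V0: "0 < V" using c n1 by (intro less_le_trans[OF _ VN]) simp
    have \<sigma>: "0 < \<sigma>" "\<sigma>\<^sup>2 = V" using V0 by (auto simp: \<sigma>_def)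
    have \<theta>0: "0 \<le> \<theta>" using \<sigma> by (simp add: \<theta>_def)
    have \<theta>2: "\<theta>\<^sup>2 \<le> 1 / (c * n)"
      using VN V0 c n1 by (simp add: \<theta>_def power_divide \<sigma> field_simps)
    have \<theta>1: "\<theta> \<le> 1 / sqrt (c * n)"
      using real_sqrt_le_mono[OF \<theta>2] \<theta>0 by (simp add: real_sqrt_divide)
    have diff: "F x - F y = (wis n k x - wis n k y) / \<sigma>" for x y
      by (simp add: F_def diff_divide_distrib)
    have mean: "expect F = 0" by (simp add: F_def E_def)
    have var: "expect (\<lambda>x. (F x)\<^sup>2) = 1"
      using V0 \<sigma> by (simp add: F_def power_divide V_def E_def)
    have c1: "\<bar>F x - F (x(i := y))\<bar> \<le> \<theta>" if "i \<in> {1..n}" for i x y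
      unfolding diff \<theta>_def using wis_diff_bound[OF that, of k x y] \<sigma>
      by (simp add: abs_divide divide_right_mono)
    have c2: "\<bar>F x - F (x(i := y)) - F (x(j := v)) + F (x(i := y, j := v))\<bar> \<le> 2 * real (n ^ (k - 2)) / \<sigma>"
      if "i \<in> {1..n}" "j \<in> {1..n}" "i \<noteq> j" for i j x y v
    proof -
      have "F x - F (x(i := y)) - F (x(j := v)) + F (x(i := y, j := v))
        = (wis n k x - wis n k (x(i := y)) - wis n k (x(j := v)) + wis n k (x(i := y, j := v))) / \<sigma>"
        by (simp add: F_def diff_divide_distrib add_divide_distrib)
      also have "\<bar>\<dots>\<bar> \<le> 2 * real (n ^ (k - 2)) / \<sigma>"
        using wis_second_diff_bound[OF that, of k x y v] \<sigma> by (simp only: abs_divide abs_of_pos divide_right_mono less_imp_le)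
      finally show ?thesis .
    qed
    have nc2: "real n * (2 * real (n ^ (k - 2)) / \<sigma>) = 2 * \<theta>"
    proof -
      have "k - 1 = Suc (k - 2)" using k by simp
      hence "real n ^ (k - 1) = real n * real n ^ (k - 2)" by (simp only: power_Suc)
      thus ?thesis by (simp add: \<theta>_def)
    qed
    have card: "card {1..n} = n" by simp
    have berry_esseen: "\<bar>expect (\<lambda>x. of_bool (F x \<le> z)) - Phi z\<bar> \<le>
      2 * ((real (card {1..n}) * (2 * real (n ^ (k - 2)) / \<sigma>))\<^sup>2 + real (card {1..n}) * (2 * real (n ^ (k - 2)) / \<sigma>)
        + 3 * sqrt (real (card {1..n})) * (\<theta> * (\<theta> + real (card {1..n}) * (2 * real (n ^ (k - 2)) / \<sigma>))))" for z
    proof (rule second_order_berry_esseen[where F = F and ?c1.0 = \<theta> and ?c2.0 = "2 * real (n ^ (k - 2)) / \<sigma>", OF mean var])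
      show "\<bar>F x - F (x(i := y))\<bar> \<le> \<theta>" if "i \<in> {1..n}" for i x y by (rule c1[OF that])
      show "\<bar>F x - F (x(i := y)) - F (x(j := v)) + F (x(i := y, j := v))\<bar> \<le> 2 * real (n ^ (k - 2)) / \<sigma>"
        if "i \<in> {1..n}" "j \<in> {1..n}" "i \<noteq> j" for i j x y v by (rule c2[OF that])
      show "0 \<le> 2 * real (n ^ (k - 2)) / \<sigma>" using \<sigma> by simp
    qed (rule \<theta>0)
    have "\<bar>expect (\<lambda>x. of_bool (F x \<le> z)) - Phi z\<bar> \<le> C / sqrt n" for z
    proof -
      have "\<bar>expect (\<lambda>x. of_bool (F x \<le> z)) - Phi z\<bar> \<le> 2 * ((2 * \<theta>)\<^sup>2 + 2 * \<theta> + 3 * sqrt n * (\<theta> * (\<theta> + 2 * \<theta>)))"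
        using berry_esseen[of z] unfolding card nc2 .
      also have "\<dots> = 2 * (4 * \<theta>\<^sup>2 + 2 * \<theta> + 9 * (sqrt n * \<theta>\<^sup>2))"
        by (simp add: power2_eq_square algebra_simps)
      also have "\<dots> \<le> 2 * (4 * (1 / c / sqrt n) + 2 * (1 / sqrt c / sqrt n) + 9 * (1 / c / sqrt n))"
      proof -
        have "sqrt n * \<theta>\<^sup>2 \<le> sqrt n * (1 / (c * n))" using \<theta>2 by (intro mult_left_mono) auto
        also have "\<dots> = 1 / c / sqrt n" using n1 c by (simp add: field_simps)
        finally have 1: "sqrt n * \<theta>\<^sup>2 \<le> 1 / c / sqrt n" .
        have "1 * \<theta>\<^sup>2 \<le> sqrt n * \<theta>\<^sup>2" using n1 by (intro mult_right_mono) auto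
        thus ?thesis using 1 \<theta>1 by (simp add: real_sqrt_mult)
      qed
      also have "\<dots> = C / sqrt n" by (simp add: C_def add_divide_distrib distrib_left)
      finally show ?thesis .
    qed
    thus ?thesis using V0 unfolding F_def E_def \<sigma>_def V_def by blast
  qed
  thus ?thesis by blast
qed

section \<open>Transfer to the given random variables\<close>

context prob_space
begin

text \<open>
  Each letter takes countably many values, so one coordinate at a time can be treated as a parameter.
\<close>

lemma measurable_functional_of_first:
  fixes X :: "nat \<Rightarrow> 'a \<Rightarrow> nat" and F :: "(nat \<Rightarrow> nat) \<Rightarrow> real"
  assumes X: "\<And>i. i \<ge> 1 \<Longrightarrow> X i \<in> measurable M (count_space UNIV)"
  shows "(\<lambda>\<omega>. F (\<lambda>i. if i \<in> {1..n} then X i \<omega> else 0)) \<in> borel_measurable M"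
proof (induction n arbitrary: F)
  case (Suc n)
  let ?Z = "\<lambda>n \<omega> i. if i \<in> {1..n} then X i \<omega> else 0"
  have IH: "(\<lambda>\<omega>. F ((?Z n \<omega>)(Suc n := y))) \<in> borel_measurable M" for y
    by (rule Suc.IH[of "\<lambda>x. F (x(Suc n := y))"])
  have "X (Suc n) \<in> measurable M (count_space UNIV)" by (rule X) simp
  hence "(\<lambda>\<omega>. F ((?Z n \<omega>)(Suc n := X (Suc n) \<omega>))) \<in> borel_measurable M"
    by (rule measurable_compose_countable[where f = "\<lambda>y \<omega>. F ((?Z n \<omega>)(Suc n := y))", OF IH])
  moreover have "(?Z n \<omega>)(Suc n := X (Suc n) \<omega>) = ?Z (Suc n) \<omega>" for \<omega> by (rule ext) auto
  ultimately show ?case by (simp only:)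
qed simp

text \<open>
  Almost surely the first \<open>n\<close> letters form one of finitely many words, and independence gives each of these
  its product probability. Statements about finitely many letters can thus be proved in the product
  law.
\<close>

lemma expectation_functional_of_first:
  fixes X :: "nat \<Rightarrow> 'a \<Rightarrow> nat" and F :: "(nat \<Rightarrow> nat) \<Rightarrow> real"
  assumes indep: "indep_vars (\<lambda>_. count_space UNIV) X {1..}"
    and law: "\<And>i. i \<ge> 1 \<Longrightarrow> distr M (count_space UNIV) (X i) = measure_pmf p"
    and fin: "finite (set_pmf p)"
    and F: "\<And>x y. (\<And>i. i \<in> {1..n} \<Longrightarrow> x i = y i) \<Longrightarrow> F x = F y"
  shows "(\<lambda>\<omega>. F (\<lambda>i. X i \<omega>)) \<in> borel_measurable M"
    and "expectation (\<lambda>\<omega>. F (\<lambda>i. X i \<omega>)) = measure_pmf.expectation (Pi_pmf {1..n} 0 (\<lambda>_. p)) F"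
proof -
  have X: "X i \<in> measurable M (count_space UNIV)" if "i \<ge> 1" for i
    using indep that unfolding indep_vars_def by auto
  let ?Z = "\<lambda>\<omega> i. if i \<in> {1..n} then X i \<omega> else 0"
  have FZ: "F (\<lambda>i. X i \<omega>) = F (?Z \<omega>)" for \<omega> by (rule F) simp
  show meas: "(\<lambda>\<omega>. F (\<lambda>i. X i \<omega>)) \<in> borel_measurable M"
    unfolding FZ by (rule measurable_functional_of_first[OF X])
  define A where "A = PiE_dflt {1..n} 0 (\<lambda>_. set_pmf p)"
  define B where "B x = {\<omega> \<in> space M. \<forall>i\<in>{1..n}. X i \<omega> = x i}" for x
  have finA: "finite A" unfolding A_def using fin by auto
  have single: "X i -` {y} \<inter> space M \<in> events" "prob (X i -` {y} \<inter> space M) = pmf p y" if "i \<ge> 1" for i y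
  proof -
    show "X i -` {y} \<inter> space M \<in> events" using X[OF that] by (rule measurable_sets) simp
    have "pmf p y = measure (distr M (count_space UNIV) (X i)) {y}"
      by (simp add: law[OF that] pmf.rep_eq)
    also have "\<dots> = prob (X i -` {y} \<inter> space M)" using X[OF that] by (intro measure_distr) auto
    finally show "prob (X i -` {y} \<inter> space M) = pmf p y" ..
  qed
  have B: "B x \<in> events" "prob (B x) = (\<Prod>i\<in>{1..n}. pmf p (x i))" for x
  proof -
    have "B x \<in> events \<and> prob (B x) = (\<Prod>i\<in>{1..n}. pmf p (x i))"
    proof (cases "n = 0")
      case True
      thus ?thesis by (simp add: B_def prob_space)
    next
      case False
      have eq: "B x = (\<Inter>i\<in>{1..n}. X i -` {x i} \<inter> space M)" using False by (auto simp: B_def)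
      have "prob (\<Inter>i\<in>{1..n}. X i -` {x i} \<inter> space M) = (\<Prod>i\<in>{1..n}. prob (X i -` {x i} \<inter> space M))"
        using False by (intro indep_varsD[OF indep]) auto
      also have "\<dots> = (\<Prod>i\<in>{1..n}. pmf p (x i))" by (intro prod.cong) (auto simp: single)
      finally have "prob (B x) = (\<Prod>i\<in>{1..n}. pmf p (x i))" unfolding eq .
      moreover have "B x \<in> events"
        unfolding eq using False by (intro sets.finite_INT single(1)) auto
      ultimately show ?thesis by blast
    qed
    thus "B x \<in> events" "prob (B x) = (\<Prod>i\<in>{1..n}. pmf p (x i))" by auto
  qed
  have AE: "AE \<omega> in M. \<forall>i\<in>{1..n}. X i \<omega> \<in> set_pmf p"
  proof (intro AE_finite_allI)
    fix i assume "i \<in> {1..n}"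
    hence i: "i \<ge> 1" by simp
    have "AE y in distr M (count_space UNIV) (X i). y \<in> set_pmf p"
      unfolding law[OF i] by (rule AE_measure_pmf)
    thus "AE \<omega> in M. X i \<omega> \<in> set_pmf p" by (subst (asm) AE_distr_iff[OF X[OF i]]) auto
  qed simp
  have "expectation (\<lambda>\<omega>. F (\<lambda>i. X i \<omega>)) = expectation (\<lambda>\<omega>. \<Sum>x\<in>A. F x * indicator (B x) \<omega>)"
  proof (rule integral_cong_AE[OF meas])
    show "(\<lambda>\<omega>. \<Sum>x\<in>A. F x * indicator (B x) \<omega>) \<in> borel_measurable M"
      using B(1) by (intro borel_measurable_sum borel_measurable_times borel_measurable_indicator) auto
    show "AE \<omega> in M. F (\<lambda>i. X i \<omega>) = (\<Sum>x\<in>A. F x * indicator (B x) \<omega>)"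
      using AE AE_space
    proof eventually_elim
      case (elim \<omega>)
      have ZA: "?Z \<omega> \<in> A" using elim by (auto simp: A_def PiE_dflt_def)
      have "\<omega> \<in> B x \<longleftrightarrow> x = ?Z \<omega>" if "x \<in> A" for x
        using that elim by (auto simp: B_def A_def PiE_dflt_def fun_eq_iff)
      hence "(\<Sum>x\<in>A. F x * indicator (B x) \<omega>) = (\<Sum>x\<in>A. if x = ?Z \<omega> then F (?Z \<omega>) else 0)"
        by (intro sum.cong) (auto simp: indicator_def)
      also have "\<dots> = F (?Z \<omega>)" using finA ZA by simp
      finally show ?case by (simp add: FZ)
    qed
  qed
  also have "\<dots> = (\<Sum>x\<in>A. F x * prob (B x))"
    using B(1) by (subst Bochner_Integration.integral_sum) (auto simp: less_top[symmetric])
  also have "\<dots> = (\<Sum>x\<in>A. F x * pmf (Pi_pmf {1..n} 0 (\<lambda>_. p)) x)"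
    by (intro sum.cong refl) (auto simp: B pmf_Pi A_def PiE_dflt_def)
  also have "\<dots> = measure_pmf.expectation (Pi_pmf {1..n} 0 (\<lambda>_. p)) F"
    using finA by (subst integral_measure_pmf_real[of A]) (auto simp: A_def set_Pi_pmf comp_def)
  finally show "expectation (\<lambda>\<omega>. F (\<lambda>i. X i \<omega>)) = measure_pmf.expectation (Pi_pmf {1..n} 0 (\<lambda>_. p)) F" .
qed

lemma cdf_distr_eq_expectation:
  assumes "T \<in> borel_measurable M"
  shows "cdf (distr M borel T) z = expectation (\<lambda>\<omega>. of_bool (T \<omega> \<le> z))"
proof -
  have "cdf (distr M borel T) z = prob (T -` {..z} \<inter> space M)"
    unfolding cdf_def using assms by (intro measure_distr) auto
  also have "\<dots> = expectation (indicator (T -` {..z} \<inter> space M))" by simp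
  also have "\<dots> = expectation (\<lambda>\<omega>. of_bool (T \<omega> \<le> z))"
    by (intro Bochner_Integration.integral_cong) (auto simp: indicator_def)
  finally show ?thesis .
qed

end

lemma kolmogorov_dist_le:
  "(\<And>z. \<bar>cdf \<mu> z - cdf \<nu> z\<bar> \<le> c) \<Longrightarrow> kolmogorov_dist \<mu> \<nu> \<le> c"
  unfolding kolmogorov_dist_def by (rule cSUP_least) auto

theorem theorem3p1:
  fixes M :: "'b measure" and X :: "nat \<Rightarrow> 'b \<Rightarrow> nat"
    and p :: "nat pmf" and a k :: nat
    and Y :: "nat \<Rightarrow> 'b \<Rightarrow> real" and E V :: "nat \<Rightarrow> real"
  assumes "prob_space M"
    and "prob_space.indep_vars M (\<lambda>_. count_space UNIV) X {1..}"
    and "\<And>i. i \<ge> 1 \<Longrightarrow> distr M (count_space UNIV) (X i) = measure_pmf p"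
    and "set_pmf p \<subseteq> {1..a}"
    and "\<And>j. p \<noteq> return_pmf j"
    and "k \<ge> 1"
  defines "Y \<equiv> \<lambda>n. num_wis X n k"
    and "E \<equiv> \<lambda>n. prob_space.expectation M (Y n)"
    and "V \<equiv> \<lambda>n. prob_space.variance M (Y n)"
  shows "(\<forall>n. E n = real (n choose k) * (\<Sum>x \<in> weak_comps {1..a} k. \<Prod>i = 1..a. pmf p i ^ x i)
            \<and> V n = prob_space.expectation M (\<lambda>\<omega>. (Y n \<omega>)\<^sup>2) - (E n)\<^sup>2
            \<and> prob_space.expectation M (\<lambda>\<omega>. (Y n \<omega>)\<^sup>2) = second_moment p a n k)
       \<and> (k \<ge> 2 \<longrightarrow>
            (\<exists>\<beta> C. (\<lambda>n. \<beta> n / sqrt (V n)) \<longlonglongrightarrow> 1 \<and>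
               (\<forall>n\<ge>1. kolmogorov_dist (distr M borel (\<lambda>\<omega>. (Y n \<omega> - E n) / \<beta> n))
                         std_normal_distribution \<le> C / sqrt (real n)))
          \<and> weak_conv_m (\<lambda>n. distr M borel (\<lambda>\<omega>. (Y n \<omega> - E n) / sqrt (V n)))
              std_normal_distribution)"
proof -
  interpret prob_space M by (rule assms(1))
  have fin: "finite (set_pmf p)" using assms(4) finite_subset by blast
  have p0: "0 \<notin> set_pmf p" using assms(4) by auto
  have a: "1 \<le> a" using assms(4) set_pmf_not_empty[of p] by fastforce
  define Q where "Q n = Pi_pmf {1..n} 0 (\<lambda>_. p)" for n :: nat
  have first: "(\<lambda>\<omega>. F (\<lambda>i. X i \<omega>)) \<in> borel_measurable M"
    "expectation (\<lambda>\<omega>. F (\<lambda>i. X i \<omega>)) = measure_pmf.expectation (Q n) F"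
    if F: "\<And>x y. (\<And>i. i \<in> {1..n} \<Longrightarrow> x i = y i) \<Longrightarrow> F x = F y" for n and F :: "(nat \<Rightarrow> nat) \<Rightarrow> real"
    unfolding Q_def
    by (rule expectation_functional_of_first[OF assms(2) _ fin F]; (rule assms(3))?; assumption)+
  have local: "wis n k x = wis n k y" if "\<And>i. i \<in> {1..n} \<Longrightarrow> x i = y i" for n x y
    using that by (rule wis_cong)
  have Y: "Y n \<omega> = wis n k (\<lambda>i. X i \<omega>)" for n \<omega> by (simp add: Y_def num_wis_eq_wis)
  have lift: "expectation (\<lambda>\<omega>. f (Y n \<omega>)) = measure_pmf.expectation (Q n) (\<lambda>x. f (wis n k x))"
    "(\<lambda>\<omega>. f (Y n \<omega>)) \<in> borel_measurable M" for f :: "real \<Rightarrow> real" and n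
  proof -
    have loc: "f (wis n k x) = f (wis n k y)" if "\<And>i. i \<in> {1..n} \<Longrightarrow> x i = y i" for x y
      using local[OF that] by simp
    show "expectation (\<lambda>\<omega>. f (Y n \<omega>)) = measure_pmf.expectation (Q n) (\<lambda>x. f (wis n k x))"
      unfolding Y by (rule first(2)) (rule loc)
    show "(\<lambda>\<omega>. f (Y n \<omega>)) \<in> borel_measurable M"
      unfolding Y by (rule first(1)) (rule loc)
  qed
  have on_support: "measure_pmf.expectation (Q n) (\<lambda>x. f (wis n k x)) = measure_pmf.expectation (Q n) (\<lambda>x. f (bounded_wis x n k a))"
    for f :: "real \<Rightarrow> real" and n
  proof (intro integral_cong_AE)
    show "AE x in Q n. f (wis n k x) = f (bounded_wis x n k a)"
    proof (unfold AE_measure_pmf_iff, rule ballI)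
      fix x assume "x \<in> set_pmf (Q n)"
      hence "x i \<le> a" if "i \<in> {1..n}" for i
        using that assms(4) by (auto simp: Q_def set_Pi_pmf PiE_dflt_def)
      hence "wis n k x = bounded_wis x n k a" by (rule wis_eq_bounded_wis)
      thus "f (wis n k x) = f (bounded_wis x n k a)" by simp
    qed
  qed auto
  have E: "E n = measure_pmf.expectation (Q n) (wis n k)" for n
    using lift(1)[of "\<lambda>y. y" n] by (simp add: E_def)
  have V: "V n = wis_variance p n k" for n
    using lift(1)[of "\<lambda>y. (y - E n)\<^sup>2" n] E[of n] by (simp add: V_def E_def Q_def)
  have intQ: "integrable (measure_pmf (Q n)) f" for n and f :: "_ \<Rightarrow> real"
    unfolding Q_def using fin by (intro integrable_measure_pmf_finite) (auto simp: set_Pi_pmf)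
  have moments: "E n = real (n choose k) * (\<Sum>x \<in> weak_comps {1..a} k. \<Prod>i = 1..a. pmf p i ^ x i)"
    "V n = expectation (\<lambda>\<omega>. (Y n \<omega>)\<^sup>2) - (E n)\<^sup>2"
    "expectation (\<lambda>\<omega>. (Y n \<omega>)\<^sup>2) = second_moment p a n k" for n
  proof -
    show "E n = real (n choose k) * (\<Sum>x \<in> weak_comps {1..a} k. \<Prod>i = 1..a. pmf p i ^ x i)"
      using on_support[of n "\<lambda>y. y"] expectation_bounded_wis[OF fin p0, of n k a]
      unfolding E complete_hom_def iid_def[OF fin p0] Q_def by simp
    show "expectation (\<lambda>\<omega>. (Y n \<omega>)\<^sup>2) = second_moment p a n k"
      using lift(1)[of "\<lambda>y. y\<^sup>2" n] on_support[of n "\<lambda>y. y\<^sup>2"] expectation_bounded_wis_mult[OF fin p0, of n k a k a]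
      unfolding second_moment_eq[OF a] iid_def[OF fin p0] Q_def by (simp add: power2_eq_square)
    have "V n = measure_pmf.expectation (Q n) (\<lambda>x. (wis n k x)\<^sup>2) - (E n)\<^sup>2"
      unfolding V E using intQ by (subst measure_pmf.variance_eq) (auto simp: Q_def)
    thus "V n = expectation (\<lambda>\<omega>. (Y n \<omega>)\<^sup>2) - (E n)\<^sup>2" using lift(1)[of "\<lambda>y. y\<^sup>2" n] by simp
  qed
  define T where "T n \<omega> = (Y n \<omega> - E n) / sqrt (V n)" for n \<omega>
  have T_meas: "T n \<in> borel_measurable M" for n
    using lift(2)[of "\<lambda>y. (y - E n) / sqrt (V n)" n] by (simp add: T_def[abs_def])
  have cdf_T: "cdf (distr M borel (T n)) z
      = measure_pmf.expectation (Q n) (\<lambda>x. of_bool ((wis n k x - E n) / sqrt (V n) \<le> z))" for n z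
    unfolding cdf_distr_eq_expectation[OF T_meas] T_def by (rule lift(1))
  have clt: "(\<exists>\<beta> C. (\<lambda>n. \<beta> n / sqrt (V n)) \<longlonglongrightarrow> 1 \<and>
      (\<forall>n\<ge>1. kolmogorov_dist (distr M borel (\<lambda>\<omega>. (Y n \<omega> - E n) / \<beta> n)) std_normal_distribution \<le> C / sqrt (real n)))
    \<and> weak_conv_m (\<lambda>n. distr M borel (\<lambda>\<omega>. (Y n \<omega> - E n) / sqrt (V n))) std_normal_distribution"
    if k: "k \<ge> 2"
  proof -
    obtain u v where uv: "u < v" "u \<in> set_pmf p" "v \<in> set_pmf p"
    proof -
      obtain u where u: "u \<in> set_pmf p" using set_pmf_not_empty by fast
      have "\<not> set_pmf p \<subseteq> {u}" using assms(5)[of u] set_pmf_subset_singleton[of p u] by simp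
      then obtain v where "v \<in> set_pmf p" "v \<noteq> u" by auto
      thus thesis using u that[of u v] that[of v u] by (cases "u < v") auto
    qed
    obtain C N where CN: "\<And>n. N \<le> n \<Longrightarrow> 0 < V n"
      "\<And>n z. N \<le> n \<Longrightarrow> \<bar>cdf (distr M borel (T n)) z - cdf std_normal_distribution z\<bar> \<le> C / sqrt n"
      using wis_berry_esseen[OF fin uv k] unfolding cdf_T E V Q_def Phi_def by blast
    \<comment> \<open>For \<open>n < N\<close>, where \<open>V n\<close> may be zero, the trivial bound 1 on the distance is below
       \<open>sqrt N / sqrt n\<close>.\<close>
    define C' where "C' = max C (sqrt (real N))"
    have "kolmogorov_dist (distr M borel (T n)) std_normal_distribution \<le> C' / sqrt n" if n: "n \<ge> 1" for n
    proof (rule kolmogorov_dist_le)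
      fix z
      show "\<bar>cdf (distr M borel (T n)) z - cdf std_normal_distribution z\<bar> \<le> C' / sqrt n"
      proof (cases "N \<le> n")
        case True
        have "C / sqrt n \<le> C' / sqrt n" by (intro divide_right_mono) (auto simp: C'_def)
        thus ?thesis using CN(2)[OF True, of z] by linarith
      next
        case False
        interpret T: real_distribution "distr M borel (T n)" by (rule real_distribution_distr[OF T_meas])
        have "\<bar>cdf (distr M borel (T n)) z - cdf std_normal_distribution z\<bar> \<le> 1"
          using T.cdf_nonneg[of z] T.cdf_bounded_prob[of z] Phi_nonneg[of z] Phi_le_1[of z]
          unfolding Phi_def by linarith
        also have "1 \<le> sqrt N / sqrt n" using False n by (simp add: le_divide_eq)
        also have "\<dots> \<le> C' / sqrt n" by (intro divide_right_mono) (auto simp: C'_def)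
        finally show ?thesis .
      qed
    qed
    moreover have "(\<lambda>n. sqrt (V n) / sqrt (V n)) \<longlonglongrightarrow> 1"
    proof (rule tendsto_eventually)
      show "eventually (\<lambda>n. sqrt (V n) / sqrt (V n) = 1) sequentially"
        using eventually_ge_at_top[of N] by eventually_elim (use CN(1) in fastforce)
    qed
    moreover have "weak_conv_m (\<lambda>n. distr M borel (T n)) std_normal_distribution"
      unfolding weak_conv_m_def weak_conv_def
    proof (intro allI impI)
      fix z
      show "(\<lambda>n. cdf (distr M borel (T n)) z) \<longlonglongrightarrow> cdf std_normal_distribution z"
      proof (rule LIM_zero_cancel, rule Lim_null_comparison)
        show "eventually (\<lambda>n. norm (cdf (distr M borel (T n)) z - cdf std_normal_distribution z) \<le> C / sqrt (real n)) sequentially"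
          using eventually_ge_at_top[of N] by eventually_elim (simp add: CN(2))
        show "(\<lambda>n. C / sqrt (real n)) \<longlonglongrightarrow> 0" by real_asymp
      qed
    qed
    ultimately show ?thesis
      unfolding T_def by (intro conjI exI[of _ "\<lambda>n. sqrt (V n)"] exI[of _ C'] allI impI)
  qed
  show ?thesis using moments clt by blast
qed

end
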